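(* Let $\rho=\rho_g(\mathbf{l},\mathbf{m};S)$ be an $n$-mode Gaussian state in $\Gamma(\mathbb{C}^n)$. Let $S$ have eigenvalues $\lambda_1\ge\cdots\ge\lambda_{2n}$ with respective real orthonormal eigenvectors $\mathbf{b}_1,\dots,\mathbf{b}_{2n}$, write $\begin{pmatrix}\mathbf{l}\\ -\mathbf{m}\end{pmatrix}=\sum_{j=1}^{2n}\tau_j\mathbf{b}_j$, and put $\alpha_j=\frac{\lambda_j-1/2}{\lambda_j+1/2}$, $1\le j\le2n$. Then the probability distribution of the total number operator $N$ in the state $\rho$ satisfies: (i) $\displaystyle\Pr(N=0)=\prod_{j=1}^{2n}\sqrt{1-\alpha_j}\,\exp\left[-\tfrac12\tau_j^2(1-\alpha_j)\right]$; (ii) $\displaystyle\langle N\rangle=\frac12\left[\mathrm{Tr}\left(S-\tfrac12I_{2n}\right)+\left\|\begin{pmatrix}\mathbf{l}\\ -\mathbf{m}\end{pmatrix}\right\|^2\right]$; (iii) $\displaystyle\mathrm{Variance}(N)=\frac12\mathrm{Tr}\left(S-\tfrac12I_{2n}\right)\left(S+\tfrac12I_{2n}\right)+\begin{pmatrix}\mathbf{l}\\ -\mathbf{m}\end{pmatrix}^TS\begin{pmatrix}\mathbf{l}\\ -\mathbf{m}\end{pmatrix}$.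
   Context: $\Gamma(\mathbb{C}^n)=\bigoplus_{r\ge0}(\mathbb{C}^n)^{\circledS r}$ is the boson (symmetric) Fock space over $\mathbb{C}^n$ (inner products are linear in the second variable). For $\mathbf{u}\in\mathbb{C}^n$ the exponential vector is $\mathbf{e}(\mathbf{u})=\bigoplus_{r\ge0}\mathbf{u}^{\otimes r}/\sqrt{r!}$. The Weyl operator $W(\mathbf{u})$ is the unitary operator on $\Gamma(\mathbb{C}^n)$ determined by $W(\mathbf{u})\mathbf{e}(\mathbf{v})=e^{-\frac12\|\mathbf{u}\|^2-\langle\mathbf{u}|\mathbf{v}\rangle}\mathbf{e}(\mathbf{u}+\mathbf{v})$ for all $\mathbf{v}\in\mathbb{C}^n$. A state is a positive operator of trace one. The $n$-mode Gaussian state $\rho_g(\mathbf{l},\mathbf{m};S)$, with $\mathbf{l},\mathbf{m}\in\mathbb{R}^n$ and $S$ a real symmetric $2n\times2n$ matrix satisfying $2S+iJ_{2n}\ge0$, $J_{2n}=\begin{bmatrix} 0 & -I_n \\ I_n & 0 \end{bmatrix}$, is the unique state $\rho$ with $$\mathrm{Tr}\,\rho W(\mathbf{x}+i\mathbf{y})=\exp\left[-i\sqrt2(\mathbf{l}^T\mathbf{x}-\mathbf{m}^T\mathbf{y})-\begin{pmatrix}\mathbf{x}\\ \mathbf{y}\end{pmatrix}^TS\begin{pmatrix}\mathbf{x}\\ \mathbf{y}\end{pmatrix}\right],\quad\mathbf{x},\mathbf{y}\in\mathbb{R}^n.$$ The total number operator $N$ is the self-adjoint operator acting as multiplication by $r$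 on the $r$-particle subspace $(\mathbb{C}^n)^{\circledS r}$, $r=0,1,2,\dots$. Its distribution in $\rho$ is $\Pr(N=k)=\mathrm{Tr}\,\rho P_k$ with $P_k$ the projection onto the $k$-particle subspace; $\langle N\rangle$ and $\mathrm{Variance}(N)$ are the mean and variance of this distribution. *)

theory Defs
  imports "HOL-Analysis.Analysis" "HOL-Library.Nonpos_Ints"
begin

section \<open>Boson Fock space\<close>

text \<open>
  A tensor of order \<open>r\<close> over \<open>complex ^ 'n\<close> is given by its coordinates in the
  standard basis, one for each index word of length \<open>r\<close>; it is symmetric iff the
  coordinate does not change when the word is rearranged. An element of the Fock space, the Hilbert
  space direct sum over all \<open>r\<close>, is thus a square-summable symmetric function of words.
\<close>

definition sym_l2 :: "('n list \<Rightarrow> complex) set" where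
  "sym_l2 = {f. (\<forall>xs ys. mset xs = mset ys \<longrightarrow> f xs = f ys) \<and>
                (\<lambda>xs. (norm (f xs))\<^sup>2) summable_on UNIV}"

lemma sym_l2_I:
  assumes "\<And>xs ys. mset xs = mset ys \<Longrightarrow> f xs = f ys" "(\<lambda>xs. (norm (f xs))\<^sup>2) summable_on UNIV"
  shows "f \<in> sym_l2"
  using assms unfolding sym_l2_def by blast

lemma sym_l2_D:
  assumes "f \<in> sym_l2"
  shows "mset xs = mset ys \<Longrightarrow> f xs = f ys" "(\<lambda>xs. (norm (f xs))\<^sup>2) summable_on UNIV"
  using assms unfolding sym_l2_def by blast+

typedef ('n::finite) fock = "sym_l2 :: ('n list \<Rightarrow> complex) set"
  morphisms coord Abs_fock
  by (rule exI[of _ "\<lambda>_. 0"]) (simp add: sym_l2_def)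

setup_lifting type_definition_fock

lemma coord_sq_summable: "(\<lambda>xs. (norm (coord f xs))\<^sup>2) summable_on UNIV"
  by (rule sym_l2_D(2)[OF coord])

lemma l2_add:
  fixes f g :: "'a \<Rightarrow> complex"
  assumes "(\<lambda>x. (norm (f x))\<^sup>2) summable_on UNIV" "(\<lambda>x. (norm (g x))\<^sup>2) summable_on UNIV"
  shows "(\<lambda>x. (norm (f x + g x))\<^sup>2) summable_on UNIV"
proof (rule summable_on_comparison_test)
  show "(\<lambda>x. 2 * (norm (f x))\<^sup>2 + 2 * (norm (g x))\<^sup>2) summable_on UNIV"
    by (intro summable_on_add summable_on_cmult_right assms)
  show "(norm (f x + g x))\<^sup>2 \<le> 2 * (norm (f x))\<^sup>2 + 2 * (norm (g x))\<^sup>2" for x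
  proof -
    have "(norm (f x + g x))\<^sup>2 \<le> (norm (f x) + norm (g x))\<^sup>2"
      by (intro power_mono norm_triangle_ineq) simp
    also have "\<dots> \<le> 2 * (norm (f x))\<^sup>2 + 2 * (norm (g x))\<^sup>2"
      using sum_squares_bound[of "norm (f x)" "norm (g x)"]
      by (simp add: power2_eq_square algebra_simps)
    finally show ?thesis .
  qed
qed auto

lemma l2_scale:
  fixes f :: "'a \<Rightarrow> complex"
  assumes "(\<lambda>x. (norm (f x))\<^sup>2) summable_on UNIV"
  shows "(\<lambda>x. (norm (c * f x))\<^sup>2) summable_on UNIV"
  unfolding norm_mult power_mult_distrib by (intro summable_on_cmult_right assms)

lemma l2_prod:
  fixes f g :: "'a \<Rightarrow> complex"
  assumes "(\<lambda>x. (norm (f x))\<^sup>2) summable_on UNIV" "(\<lambda>x. (norm (g x))\<^sup>2) summable_on UNIV"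
  shows "(\<lambda>x. cnj (f x) * g x) summable_on UNIV"
proof (rule abs_summable_summable, rule summable_on_comparison_test)
  show "(\<lambda>x. (norm (f x))\<^sup>2 + (norm (g x))\<^sup>2) summable_on UNIV"
    by (intro summable_on_add assms)
  show "norm (cnj (f x) * g x) \<le> (norm (f x))\<^sup>2 + (norm (g x))\<^sup>2" for x
  proof -
    have "norm (cnj (f x) * g x) = norm (f x) * norm (g x)" by (simp add: norm_mult)
    moreover have "0 \<le> norm (f x) * norm (g x)" by simp
    ultimately show ?thesis
      using sum_squares_bound[of "norm (f x)" "norm (g x)"] by linarith
  qed
qed auto

lemma sym_l2_scale: "f \<in> sym_l2 \<Longrightarrow> (\<lambda>xs. c * f xs) \<in> sym_l2"
  by (rule sym_l2_I, erule (1) arg_cong[OF sym_l2_D(1)], rule l2_scale, erule sym_l2_D(2))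

lemma sym_l2_add: "f \<in> sym_l2 \<Longrightarrow> g \<in> sym_l2 \<Longrightarrow> (\<lambda>xs. f xs + g xs) \<in> sym_l2"
  by (rule sym_l2_I, rule arg_cong2[where f = "(+)"], erule (1) sym_l2_D(1), erule (1) sym_l2_D(1),
      rule l2_add, erule sym_l2_D(2), erule sym_l2_D(2))

definition cinner :: "'n::finite fock \<Rightarrow> 'n fock \<Rightarrow> complex" where
  "cinner f g = (\<Sum>\<^sub>\<infinity>xs. cnj (coord f xs) * coord g xs)"

lift_definition scaleC :: "complex \<Rightarrow> 'n::finite fock \<Rightarrow> 'n fock"  (infixr \<open>*\<^sub>C\<close> 75)
  is "\<lambda>c f xs. c * f xs"
  by (rule sym_l2_scale)

instantiation fock :: (finite) real_vector
begin
lift_definition zero_fock :: "'a fock" is "\<lambda>_. 0" by (simp add: sym_l2_def)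
lift_definition plus_fock :: "'a fock \<Rightarrow> 'a fock \<Rightarrow> 'a fock" is "\<lambda>f g xs. f xs + g xs"
  by (rule sym_l2_add)
definition uminus_fock :: "'a fock \<Rightarrow> 'a fock" where "uminus_fock f = (- 1) *\<^sub>C f"
definition minus_fock :: "'a fock \<Rightarrow> 'a fock \<Rightarrow> 'a fock" where "minus_fock f g = f + (- g)"
definition scaleR_fock :: "real \<Rightarrow> 'a fock \<Rightarrow> 'a fock" where
  "scaleR_fock r f = complex_of_real r *\<^sub>C f"
instance
  by standard
    (simp_all add: coord_inject[symmetric] fun_eq_iff plus_fock.rep_eq zero_fock.rep_eq
      scaleC.rep_eq uminus_fock_def minus_fock_def scaleR_fock_def algebra_simps)
end

lemma cinner_summable: "(\<lambda>xs. cnj (coord f xs) * coord g xs) summable_on UNIV"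
  by (intro l2_prod coord_sq_summable)

lemma cinner_commute: "cinner g f = cnj (cinner f g)"
  unfolding cinner_def by (simp flip: infsum_cnj add: mult.commute)

lemma cinner_add_left: "cinner (f + g) h = cinner f h + cinner g h"
  unfolding cinner_def plus_fock.rep_eq complex_cnj_add distrib_right
  by (rule infsum_add) (rule cinner_summable)+

lemma cinner_scaleC_left: "cinner (c *\<^sub>C f) g = cnj c * cinner f g"
  unfolding cinner_def scaleC.rep_eq
  by (simp add: mult.assoc infsum_cmult_right cinner_summable)

lemma cinner_self: "cinner f f = complex_of_real (\<Sum>\<^sub>\<infinity>xs. (norm (coord f xs))\<^sup>2)"
proof -
  have "((\<lambda>xs. complex_of_real ((norm (coord f xs))\<^sup>2)) has_sum
          complex_of_real (\<Sum>\<^sub>\<infinity>xs. (norm (coord f xs))\<^sup>2)) UNIV"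
    by (intro has_sum_of_real has_sum_infsum coord_sq_summable)
  moreover have "complex_of_real ((norm z)\<^sup>2) = cnj z * z" for z
    using complex_norm_square[of z] by (simp add: mult.commute)
  ultimately show ?thesis
    unfolding cinner_def by (simp add: infsumI del: of_real_power)
qed

lemma cinner_self_eq_0: "Re (cinner f f) = 0 \<longleftrightarrow> f = 0"
proof
  assume "Re (cinner f f) = 0"
  then have z: "(\<Sum>\<^sub>\<infinity>xs. (norm (coord f xs))\<^sup>2) = 0" by (simp add: cinner_self)
  have "(norm (coord f xs))\<^sup>2 = 0" for xs
    by (rule nonneg_infsum_le_0D[OF _ coord_sq_summable]) (simp_all add: z)
  then show "f = 0"
    by (simp add: coord_inject[symmetric] fun_eq_iff zero_fock.rep_eq)
qed (simp add: cinner_self zero_fock.rep_eq)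

instantiation fock :: (finite) real_inner
begin
definition inner_fock :: "'a fock \<Rightarrow> 'a fock \<Rightarrow> real" where
  "inner_fock f g = Re (cinner f g)"
definition norm_fock :: "'a fock \<Rightarrow> real" where
  "norm_fock f = sqrt (inner f f)"
definition sgn_fock :: "'a fock \<Rightarrow> 'a fock" where
  "sgn_fock f = f /\<^sub>R norm f"
definition dist_fock :: "'a fock \<Rightarrow> 'a fock \<Rightarrow> real" where
  "dist_fock f g = norm (f - g)"
definition uniformity_fock :: "('a fock \<times> 'a fock) filter" where
  "uniformity_fock = (INF e\<in>{0<..}. principal {(f, g). dist f g < e})"
definition open_fock :: "'a fock set \<Rightarrow> bool" where
  "open_fock U \<longleftrightarrow> (\<forall>f\<in>U. \<forall>\<^sub>F (f', g) in uniformity. f' = f \<longrightarrow> g \<in> U)"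
instance
proof
  fix f g h :: "'a fock" and r :: real
  show "inner f g = inner g f"
    unfolding inner_fock_def by (subst cinner_commute) simp
  show "inner (f + g) h = inner f h + inner g h"
    by (simp add: inner_fock_def cinner_add_left)
  show "inner (r *\<^sub>R f) g = r * inner f g"
    by (simp add: inner_fock_def scaleR_fock_def cinner_scaleC_left)
  show "0 \<le> inner f f"
    by (simp add: inner_fock_def cinner_self infsum_nonneg)
  show "inner f f = 0 \<longleftrightarrow> f = 0"
    by (simp add: inner_fock_def cinner_self_eq_0)
qed (simp_all add: norm_fock_def sgn_fock_def dist_fock_def uniformity_fock_def open_fock_def)
end

lemma sum_words_prod_list:
  fixes a :: "'n::finite \<Rightarrow> real"
  shows "(\<Sum>xs | length xs = r. prod_list (map a xs)) = (\<Sum>i\<in>UNIV. a i) ^ r"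
proof (induction r)
  case (Suc r)
  have eq: "{xs :: 'n list. length xs = Suc r} = (\<lambda>(i, xs). i # xs) ` (UNIV \<times> {xs. length xs = r})"
    by (auto simp: length_Suc_conv image_iff)
  have "(\<Sum>xs | length xs = Suc r. prod_list (map a xs)) =
        (\<Sum>(i, xs)\<in>UNIV \<times> {xs. length xs = r}. a i * prod_list (map a xs))"
    unfolding eq by (subst sum.reindex) (auto simp: inj_on_def case_prod_unfold)
  also have "\<dots> = (\<Sum>i\<in>UNIV. a i) * (\<Sum>xs | length xs = r. prod_list (map a xs))"
    by (simp add: sum.cartesian_product[symmetric] sum_product)
  finally show ?case by (simp add: Suc.IH)
qed simp

lemma expvec_l2:
  fixes u :: "complex ^ 'n"
  shows "(\<lambda>xs. (norm (prod_list (map (\<lambda>i. u $ i) xs) /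
            complex_of_real (sqrt (fact (length xs)))))\<^sup>2) summable_on UNIV" (is "?h summable_on _")
proof (rule nonneg_bdd_above_summable_on)
  define a where "a i = (norm (u $ i))\<^sup>2" for i
  define s where "s = (\<Sum>i\<in>UNIV. a i)"
  have s0: "0 \<le> s" by (simp add: s_def a_def sum_nonneg)
  have np: "(norm (prod_list (map (\<lambda>i. u $ i) xs)))\<^sup>2 = prod_list (map a xs)" for xs
    by (induction xs) (simp_all add: a_def norm_mult power_mult_distrib)
  have h: "?h xs = prod_list (map a xs) / fact (length xs)" for xs
    by (simp add: norm_divide power_divide np)
  have fin: "finite {xs :: 'n list. length xs = r}" for r
    using finite_lists_length_eq[of "UNIV :: 'n set" r] by simp
  have r: "(\<Sum>xs | length xs = r. ?h xs) = s ^ r / fact r" for r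
    unfolding h s_def sum_words_prod_list[symmetric] sum_divide_distrib by (rule sum.cong) auto
  have "sum ?h F \<le> exp s" if F: "finite F" for F
  proof -
    define R where "R = Max (insert 0 (length ` F))"
    have "F \<subseteq> (\<Union>r\<le>R. {xs. length xs = r})"
      using F by (auto simp: R_def)
    then have "sum ?h F \<le> sum ?h (\<Union>r\<le>R. {xs. length xs = r})"
      by (intro sum_mono2) (auto intro: fin)
    also have "\<dots> = (\<Sum>r\<le>R. \<Sum>xs | length xs = r. ?h xs)"
      by (rule sum.UNION_disjoint) (auto intro: fin)
    also have "\<dots> = (\<Sum>r\<le>R. s ^ r / fact r)" unfolding r ..
    also have "\<dots> \<le> exp s"
    proof -
      have "(\<lambda>r. s ^ r / fact r) sums exp s"
        using exp_converges[of s] unfolding real_scaleR_def divide_inverse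
        by (simp only: mult.commute)
      then have "summable (\<lambda>r. s ^ r / fact r)" "(\<Sum>r. s ^ r / fact r) = exp s"
        by (rule sums_summable, rule sums_unique[symmetric])
      moreover have "0 \<le> s ^ r / fact r" for r using s0 by simp
      ultimately show ?thesis
        using sum_le_suminf[of "\<lambda>r. s ^ r / fact r" "{..R}"] by (metis finite_atMost)
    qed
    finally show ?thesis .
  qed
  then show "bdd_above (sum ?h ` {F. F \<subseteq> UNIV \<and> finite F})"
    by (intro bdd_aboveI[where M = "exp s"]) blast
qed (rule zero_le_power2)

lift_definition expvec :: "complex ^ 'n \<Rightarrow> 'n::finite fock"
  is "\<lambda>u xs. prod_list (map (\<lambda>i. u $ i) xs) / complex_of_real (sqrt (fact (length xs)))"
proof -
  fix u :: "complex ^ 'n"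
  show "(\<lambda>xs. prod_list (map (\<lambda>i. u $ i) xs) / complex_of_real (sqrt (fact (length xs)))) \<in> sym_l2"
  proof (rule sym_l2_I)
    fix xs ys :: "'n list"
    assume eq: "mset xs = mset ys"
    have "prod_list (map (\<lambda>i. u $ i) zs) = prod_mset (image_mset (\<lambda>i. u $ i) (mset zs))" for zs
      by (induction zs) simp_all
    then show "prod_list (map (\<lambda>i. u $ i) xs) / complex_of_real (sqrt (fact (length xs))) =
          prod_list (map (\<lambda>i. u $ i) ys) / complex_of_real (sqrt (fact (length ys)))"
      by (simp only: eq mset_eq_length[OF eq])
  qed (rule expvec_l2)
qed

lift_definition particle_proj :: "nat \<Rightarrow> 'n::finite fock \<Rightarrow> 'n fock"
  is "\<lambda>k f xs. if length xs = k then f xs else 0"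
proof (rule sym_l2_I)
  fix k and f :: "'n list \<Rightarrow> complex" and xs ys :: "'n list"
  assume f: "f \<in> sym_l2" and eq: "mset xs = mset ys"
  show "(if length xs = k then f xs else 0) = (if length ys = k then f ys else 0)"
    by (simp only: mset_eq_length[OF eq] sym_l2_D(1)[OF f eq])
next
  fix k and f :: "'n list \<Rightarrow> complex"
  assume f: "f \<in> sym_l2"
  show "(\<lambda>xs. (norm (if length xs = k then f xs else 0))\<^sup>2) summable_on UNIV"
    by (rule summable_on_comparison_test[OF sym_l2_D(2)[OF f]]) simp_all
qed


section \<open>Operators, trace and states\<close>

definition bounded_clinear :: "('n::finite fock \<Rightarrow> 'n fock) \<Rightarrow> bool" where
  "bounded_clinear A \<longleftrightarrow> bounded_linear A \<and> (\<forall>c f. A (c *\<^sub>C f) = c *\<^sub>C A f)"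

definition unitary_op :: "('n::finite fock \<Rightarrow> 'n fock) \<Rightarrow> bool" where
  "unitary_op U \<longleftrightarrow> bounded_clinear U \<and> surj U \<and> (\<forall>f g. cinner (U f) (U g) = cinner f g)"

definition positive_op :: "('n::finite fock \<Rightarrow> 'n fock) \<Rightarrow> bool" where
  "positive_op A \<longleftrightarrow> bounded_clinear A \<and> (\<forall>f. cinner f (A f) \<in> \<real>\<^sub>\<ge>\<^sub>0)"

text \<open>An orthonormal basis is a complete (equivalently, maximal) orthonormal set.\<close>

definition orthonormal_basis :: "'n::finite fock set \<Rightarrow> bool" where
  "orthonormal_basis B \<longleftrightarrow>
     (\<forall>b\<in>B. \<forall>c\<in>B. cinner b c = (if b = c then 1 else 0)) \<and>
     (\<forall>f. (\<forall>b\<in>B. cinner b f = 0) \<longrightarrow> f = 0)"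

text \<open>
  On a complex Hilbert space, a bounded operator is of trace class iff its diagonal is summable in
  every orthonormal basis, and the sum is then the same in all of them.
\<close>

definition has_trace :: "('n::finite fock \<Rightarrow> 'n fock) \<Rightarrow> complex \<Rightarrow> bool" where
  "has_trace A t \<longleftrightarrow> bounded_clinear A \<and>
     (\<forall>B. orthonormal_basis B \<longrightarrow> ((\<lambda>b. cinner b (A b)) has_sum t) B)"

definition op_trace :: "('n::finite fock \<Rightarrow> 'n fock) \<Rightarrow> complex" where
  "op_trace A = (THE t. has_trace A t)"

definition is_state :: "('n::finite fock \<Rightarrow> 'n fock) \<Rightarrow> bool" where
  "is_state \<rho> \<longleftrightarrow> positive_op \<rho> \<and> has_trace \<rho> 1"


section \<open>Weyl operators and Gaussian states\<close>

definition cdot :: "complex ^ 'n::finite \<Rightarrow> complex ^ 'n \<Rightarrow> complex" where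
  "cdot u v = (\<Sum>i\<in>UNIV. cnj (u $ i) * v $ i)"

text \<open>
  The defining condition has exactly one solution because the exponential vectors are total and
  \<open>cinner (expvec v) (expvec w) = exp (cdot v w)\<close>.
\<close>

definition weyl :: "complex ^ 'n \<Rightarrow> 'n::finite fock \<Rightarrow> 'n fock" where
  "weyl u = (THE U. unitary_op U \<and>
     (\<forall>v. U (expvec v) = exp (- complex_of_real ((norm u)\<^sup>2 / 2) - cdot u v) *\<^sub>C expvec (u + v)))"

definition stack :: "real ^ 'n \<Rightarrow> real ^ 'n \<Rightarrow> real ^ ('n::finite + 'n)" where
  "stack x y = (\<chi> i. case i of Inl a \<Rightarrow> x $ a | Inr a \<Rightarrow> y $ a)"

definition symplectic_J :: "real ^ ('n::finite + 'n) ^ ('n + 'n)" where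
  "symplectic_J = (\<chi> i j. case (i, j) of
      (Inl a, Inr b) \<Rightarrow> if a = b then -1 else 0
    | (Inr a, Inl b) \<Rightarrow> if a = b then 1 else 0
    | _ \<Rightarrow> 0)"

definition positive_matrix :: "complex ^ 'm::finite ^ 'm \<Rightarrow> bool" where
  "positive_matrix M \<longleftrightarrow> (\<forall>z. cdot z (M *v z) \<in> \<real>\<^sub>\<ge>\<^sub>0)"

definition gaussian_covariance :: "real ^ ('n::finite + 'n) ^ ('n + 'n) \<Rightarrow> bool" where
  "gaussian_covariance S \<longleftrightarrow> transpose S = S \<and>
     positive_matrix (\<chi> i j. 2 * complex_of_real (S $ i $ j) + \<i> * complex_of_real (symplectic_J $ i $ j))"

definition is_gaussian_state ::
    "real ^ 'n \<Rightarrow> real ^ 'n \<Rightarrow> real ^ ('n::finite + 'n) ^ ('n + 'n) \<Rightarrow> ('n fock \<Rightarrow> 'n fock) \<Rightarrow> bool" where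
  "is_gaussian_state l m S \<rho> \<longleftrightarrow> gaussian_covariance S \<and> is_state \<rho> \<and>
     (\<forall>x y. has_trace (\<rho> \<circ> weyl (\<chi> i. Complex (x $ i) (y $ i)))
        (exp (- \<i> * complex_of_real (sqrt 2 * (l \<bullet> x - m \<bullet> y))
              - complex_of_real (stack x y \<bullet> (S *v stack x y)))))"


section \<open>Distribution of the total number operator\<close>

text \<open>
  The number operator acts as multiplication by \<open>k\<close> on the range of \<open>particle_proj k\<close>; these
  are its spectral projections. For a state \<open>\<rho>\<close> the trace below is real, so taking the real
  part only changes the type. The sums are junk when they diverge, so statements about mean and
  variance should include summability.
\<close>

definition number_prob :: "('n::finite fock \<Rightarrow> 'n fock) \<Rightarrow> nat \<Rightarrow> real" where
  "number_prob \<rho> k = Re (op_trace (\<rho> \<circ> particle_proj k))"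

definition number_mean :: "('n::finite fock \<Rightarrow> 'n fock) \<Rightarrow> real" where
  "number_mean \<rho> = (\<Sum>\<^sub>\<infinity>k. real k * number_prob \<rho> k)"

definition number_variance :: "('n::finite fock \<Rightarrow> 'n fock) \<Rightarrow> real" where
  "number_variance \<rho> = (\<Sum>\<^sub>\<infinity>k. (real k - number_mean \<rho>)\<^sup>2 * number_prob \<rho> k)"

end

theory Submission
  imports Defs "HOL-Probability.Characteristic_Functions" "HOL-Real_Asymp.Real_Asymp"
begin

text \<open>
  The probability generating function of \<open>N\<close> can be read off the characteristic function of the
  state. For \<open>0 \<le> z < 1\<close> and \<open>s = 1 - z\<close>, the operator \<open>z ^ N\<close> is a Gaussian mixture of Weyl operators,
  \<open>z ^ N = (\<pi> s) ^ (- n) \<integral> exp (- (1 / s - 1 / 2) \<bar>u\<bar>\<^sup>2) W(u) du\<close>,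
  which is checked on exponential vectors and extends to all vectors by density. Taking the trace against
  \<open>\<rho>\<close> and integrating in the coordinates of the eigenbasis of \<open>S\<close>, where everything factorises, gives
  \<open>\<Sum>\<^sub>k Pr(N = k) (1 - s) ^ k = \<Prod>\<^sub>j (1 + s \<mu>\<^sub>j) ^ (- 1 / 2) exp (- s \<tau>\<^sub>j\<^sup>2 / (2 (1 + s \<mu>\<^sub>j)))\<close>
  with \<open>\<mu>\<^sub>j = \<lambda>\<^sub>j - 1 / 2\<close>. At \<open>s = 1\<close> this is \<open>Pr(N = 0)\<close>; the first two factorial moments are the coefficients
  of its expansion at \<open>s = 0\<close>; there sum and limit commute because the difference quotients of
  \<open>(1 - s) ^ k\<close> are bounded by their limits.
\<close>


section \<open>Dense spans and isometries in real Hilbert spaces\<close>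

text \<open>The kernel comes from the quantum Fourier inversion formula: an operator
  \<open>A\<close> is \<open>\<pi> ^ (- n)\<close> times the integral of
  \<open>Tr (A W(- u)) W(u)\<close>, and \<open>Tr (z ^ N W(u)) = s ^ (- n) exp (- (1 + z) / (2 (1 -
  z)) \<bar>u\<bar>\<^sup>2)\<close>, where \<open>(1 + z) / (2 (1 - z)) = 1 / s - 1 / 2\<close>.
  The mixture is used only through matrix elements, so no operator-valued integral occurs. The
  delicate step is the exchange of trace and integral, since \<open>\<rho> W(u)\<close> is not
  positive: its diagonal entries are dominated by the average of those of \<rho> in two orthonormal
  bases, the occupation basis and its image under \<open>W(u)\<close>, and both diagonals have sum
  1. Integrating in frame coordinates from the start avoids a change of variables. Because
  \<open>weyl\<close> and \<open>op_trace\<close> are definite descriptions, existence and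
  uniqueness have to be supplied; hence the completeness of Fock space and the totality of the
  exponential vectors. Near \<open>s = 0\<close> the generating function is known on one side only
  and finiteness of the moments is not given, so one-sided difference quotients replace
  derivatives.\<close>

lemma norm_diff_sq_parallelogram:
  fixes f a b :: "'a::real_inner"
  shows "(norm (a - b))\<^sup>2 = 2 * (norm (f - a))\<^sup>2 + 2 * (norm (f - b))\<^sup>2 - 4 * (norm (f - (1/2) *\<^sub>R (a + b)))\<^sup>2"
  by (simp add: power2_norm_eq_inner inner_diff inner_add inner_commute algebra_simps)

text \<open>Projection argument: the parallelogram law makes a minimising sequence in
  \<open>span S\<close> Cauchy, completeness gives a nearest point \<open>l\<close> in the closure,
  and minimality forces \<open>f - l\<close> to be orthogonal to \<open>S\<close>, so
  \<open>f = l\<close>.\<close>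

lemma closure_span_eq_UNIV:
  fixes S :: "'a::{real_inner, complete_space} set"
  assumes S: "\<And>x. (\<And>s. s \<in> S \<Longrightarrow> inner x s = 0) \<Longrightarrow> x = 0"
  shows "closure (span S) = UNIV"
proof (rule equalityI[OF subset_UNIV], rule subsetI)
  fix f :: 'a
  define d where "d = infdist f (span S)"
  have ne: "span S \<noteq> {}" by (metis empty_iff span_zero)
  have d0: "0 \<le> d" by (simp add: d_def infdist_nonneg)
  have dle: "d \<le> norm (f - k)" if "k \<in> span S" for k
    unfolding d_def dist_norm[symmetric] by (rule infdist_le[OF that])
  have "\<exists>k\<in>span S. norm (f - k) < d + 1 / real (Suc n)" for n
  proof -
    have "(INF a\<in>span S. dist f a) < d + 1 / real (Suc n)"
      using ne by (simp add: d_def infdist_def)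
    then show ?thesis using cInf_lessD[of "dist f ` span S"] ne by (auto simp: dist_norm)
  qed
  then obtain k where kS: "k n \<in> span S" and kd: "norm (f - k n) < d + 1 / real (Suc n)" for n
    by metis
  have bound: "(norm (k m - k n))\<^sup>2 \<le> 4 * (2 * d + 1) * (1 / real (Suc N))" if "N \<le> m" "N \<le> n" for m n N
  proof -
    have sq: "(norm (f - k j))\<^sup>2 \<le> d\<^sup>2 + (2 * d + 1) * (1 / real (Suc N))" if "N \<le> j" for j
    proof -
      define e where "e = 1 / real (Suc N)"
      have e: "0 \<le> e" "e \<le> 1" by (auto simp: e_def)
      have "1 / real (Suc j) \<le> e" unfolding e_def using that by (intro divide_left_mono) auto
      then have "norm (f - k j) \<le> d + e" using kd[of j] by linarith
      then have "(norm (f - k j))\<^sup>2 \<le> (d + e)\<^sup>2" by (intro power_mono) auto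
      also have "\<dots> \<le> d\<^sup>2 + (2 * d + 1) * e"
        using e mult_left_le[of e e] by (simp add: power2_eq_square algebra_simps)
      finally show ?thesis unfolding e_def .
    qed
    have "(1/2) *\<^sub>R (k m + k n) \<in> span S" by (intro span_scale span_add kS)
    then have "d\<^sup>2 \<le> (norm (f - (1/2) *\<^sub>R (k m + k n)))\<^sup>2" by (intro power_mono dle d0)
    then show ?thesis
      using sq[OF that(1)] sq[OF that(2)] norm_diff_sq_parallelogram[of "k m" "k n" f] by argo
  qed
  have "Cauchy k"
  proof (rule metric_CauchyI)
    fix e :: real assume e: "0 < e"
    have "(\<lambda>N. 4 * (2 * d + 1) * (1 / real (Suc N))) \<longlonglongrightarrow> 4 * (2 * d + 1) * 0"
      by (intro tendsto_mult tendsto_const LIMSEQ_Suc[OF lim_const_over_n])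
    then have "\<forall>\<^sub>F N in sequentially. 4 * (2 * d + 1) * (1 / real (Suc N)) < e\<^sup>2"
      using e by (intro order_tendstoD) auto
    then obtain N where N: "4 * (2 * d + 1) * (1 / real (Suc N)) < e\<^sup>2"
      by (auto simp: eventually_sequentially)
    have "dist (k m) (k n) < e" if "N \<le> m" "N \<le> n" for m n
    proof -
      have "(norm (k m - k n))\<^sup>2 < e\<^sup>2" using bound[OF that] N by linarith
      then show ?thesis unfolding dist_norm using e by (intro power2_less_imp_less[of _ e]) auto
    qed
    then show "\<exists>M. \<forall>m\<ge>M. \<forall>n\<ge>M. dist (k m) (k n) < e" by blast
  qed
  then obtain l where l: "k \<longlonglongrightarrow> l" using Cauchy_convergent convergent_def by blast
  have kd2: "(\<lambda>n. norm (f - k n)) \<longlonglongrightarrow> d"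
  proof (rule tendsto_sandwich[of "\<lambda>_. d" _ _ "\<lambda>n. d + 1 / real (Suc n)"])
    show "(\<lambda>n. d + 1 / real (Suc n)) \<longlonglongrightarrow> d"
      using tendsto_add[OF tendsto_const LIMSEQ_Suc[OF lim_const_over_n], of d 1] by simp
  qed (use kd dle kS in \<open>auto intro!: always_eventually less_imp_le simp del: of_nat_Suc\<close>)
  have ld: "norm (f - l) = d"
    by (rule LIMSEQ_unique[OF _ kd2]) (intro tendsto_intros l)
  have "inner (f - l) s = 0" if s: "s \<in> S" for s
  proof (cases "s = 0")
    case False
    \<comment> \<open>The minimiser of \<open>norm (f - l - t *\<^sub>R s)\<close> over
      \<open>t\<close>; a nonzero component along \<open>s\<close> would beat the distance
      \<open>d\<close>.\<close>
    define t where "t = inner (f - l) s / inner s s"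
    have "d \<le> norm (f - (l + t *\<^sub>R s))"
    proof (rule LIMSEQ_le_const)
      show "(\<lambda>n. norm (f - (k n + t *\<^sub>R s))) \<longlonglongrightarrow> norm (f - (l + t *\<^sub>R s))"
        by (intro tendsto_intros l)
      show "\<exists>N. \<forall>n\<ge>N. d \<le> norm (f - (k n + t *\<^sub>R s))"
        using s by (intro exI[of _ 0] allI impI dle span_add span_scale span_base kS)
    qed
    then have "(norm (f - l))\<^sup>2 \<le> (norm ((f - l) - t *\<^sub>R s))\<^sup>2"
      unfolding ld using d0 by (intro power_mono) (auto simp: algebra_simps)
    also have "\<dots> = (norm (f - l))\<^sup>2 - 2 * t * inner (f - l) s + t\<^sup>2 * inner s s"
      unfolding power2_norm_eq_inner
      by (simp add: inner_diff inner_commute power2_eq_square algebra_simps)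
    also have "\<dots> = (norm (f - l))\<^sup>2 - (inner (f - l) s)\<^sup>2 / inner s s"
      using False by (simp add: t_def power2_eq_square field_simps)
    finally have "(inner (f - l) s)\<^sup>2 / inner s s \<le> 0" by simp
    moreover have "0 < inner s s" using False by simp
    ultimately show ?thesis by (simp add: divide_le_0_iff)
  qed simp
  then have "f = l" using S[of "f - l"] by simp
  then show "f \<in> closure (span S)" unfolding closure_sequential using kS l by blast
qed

text \<open>Expanding the squared norm of the linearity defect involves only inner products of
  values of \<open>U\<close>; deleting \<open>U\<close> turns it into the squared norm of 0.\<close>

lemma inner_preserving_imp_linear:
  fixes U :: "'a::real_inner \<Rightarrow> 'b::real_inner"
  assumes U: "\<And>x y. inner (U x) (U y) = inner x y"
  shows "bounded_linear U"
proof
  have n: "norm (U x) = norm x" for x by (simp add: norm_eq_sqrt_inner U)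
  fix x y r
  have "norm (U (x + y) - (U x + U y)) ^ 2 = norm ((x + y) - (x + y)) ^ 2"
    unfolding power2_norm_eq_inner by (simp add: inner_diff inner_add U)
  then show "U (x + y) = U x + U y" by simp
  have "norm (U (r *\<^sub>R x) - r *\<^sub>R U x) ^ 2 = norm (r *\<^sub>R x - r *\<^sub>R x) ^ 2"
    unfolding power2_norm_eq_inner by (simp add: inner_diff inner_add U)
  then show "U (r *\<^sub>R x) = r *\<^sub>R U x" by simp
  show "\<exists>K. \<forall>x. norm (U x) \<le> norm x * K" using n by (intro exI[of _ 1]) simp
qed

text \<open>Equal Gram matrices make the assignment of \<open>e' i\<close> to \<open>e i\<close>
  isometric on finite combinations; an isometry is uniformly continuous and extends to the closure.
  Linearity is not built into the construction, since it follows from preservation of inner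
  products.\<close>

lemma ex_isometry:
  fixes e :: "'i \<Rightarrow> 'a::real_inner" and e' :: "'i \<Rightarrow> 'b::{real_inner, complete_space}"
  assumes dense: "closure (span (range e)) = UNIV"
    and gram: "\<And>i j. inner (e' i) (e' j) = inner (e i) (e j)"
  shows "\<exists>U. (\<forall>x y. inner (U x) (U y) = inner x y) \<and> (\<forall>i. U (e i) = e' i)"
proof -
  define X where "X = span (range e)"
  have "\<exists>F r. finite F \<and> x = (\<Sum>i\<in>F. r i *\<^sub>R e i)" if x: "x \<in> X" for x
  proof -
    obtain T r where T: "finite T" "T \<subseteq> range e" "x = (\<Sum>a\<in>T. r a *\<^sub>R a)"
      using x unfolding X_def span_explicit by blast
    obtain F where F: "inj_on e F" "T = e ` F"
      using T(2) by (auto simp: subset_image_inj)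
    have "x = (\<Sum>i\<in>F. r (e i) *\<^sub>R e i)"
      unfolding T(3) F(2) by (subst sum.reindex[OF F(1)]) simp
    moreover have "finite F" using finite_imageD[OF _ F(1)] T(1) F(2) by simp
    ultimately show ?thesis by (intro exI[of _ F] exI[of _ "\<lambda>i. r (e i)"] conjI)
  qed
  then have "\<exists>p. x \<in> X \<longrightarrow> finite (fst p) \<and> x = (\<Sum>i\<in>fst p. snd p i *\<^sub>R e i)" for x
    by (cases "x \<in> X") (simp_all only: split_paired_Ex fst_conv snd_conv simp_thms)
  then obtain p where p: "\<And>x. x \<in> X \<Longrightarrow> finite (fst (p x)) \<and> x = (\<Sum>i\<in>fst (p x). snd (p x) i *\<^sub>R e i)"
    using that[of "\<lambda>x. SOME p. x \<in> X \<longrightarrow> finite (fst p) \<and> x = (\<Sum>i\<in>fst p. snd p i *\<^sub>R e i)"]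
      someI_ex[of "\<lambda>p. _ \<in> X \<longrightarrow> finite (fst p) \<and> _ = (\<Sum>i\<in>fst p. snd p i *\<^sub>R e i)"] by blast
  define F r where "F x = fst (p x)" and "r x = snd (p x)" for x
  have F: "finite (F x)" "x = (\<Sum>i\<in>F x. r x i *\<^sub>R e i)" if "x \<in> X" for x
    using p[OF that] by (simp_all add: F_def r_def)
  define u where "u x = (\<Sum>i\<in>F x. r x i *\<^sub>R e' i)" for x
  have u: "inner (u x) (u y) = inner x y" if "x \<in> X" "y \<in> X" for x y
  proof -
    have "inner (u x) (u y) = inner (\<Sum>i\<in>F x. r x i *\<^sub>R e i) (\<Sum>i\<in>F y. r y i *\<^sub>R e i)"
      unfolding u_def by (simp add: inner_sum_left inner_sum_right gram)
    then show ?thesis using F[OF that(1)] F[OF that(2)] by simp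
  qed
  \<comment> \<open>The representation chosen for \<open>e i\<close> may differ from the obvious
    one, so the value is identified by showing that the difference has norm zero.\<close>
  have ue: "u (e i) = e' i" for i
  proof -
    have ei: "e i \<in> X" by (simp add: X_def span_base)
    have "inner (u (e i)) (e' i) = inner (\<Sum>j\<in>F (e i). r (e i) j *\<^sub>R e j) (e i)"
      unfolding u_def by (simp add: inner_sum_left gram)
    then have *: "inner (u (e i)) (e' i) = inner (e i) (e i)" using F[OF ei] by simp
    have "norm (u (e i) - e' i) ^ 2 = 0"
      unfolding power2_norm_eq_inner
      by (simp add: inner_diff u[OF ei ei] * gram inner_commute[of "e' i" "u (e i)"])
    then show ?thesis by simp
  qed
  have "dist (u x) (u y) = dist x y" if "x \<in> X" "y \<in> X" for x y
    unfolding dist_norm norm_eq_sqrt_inner using that by (simp add: inner_diff u)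
  then have "uniformly_continuous_on X u"
    unfolding uniformly_continuous_on_def by auto
  then obtain U where U: "uniformly_continuous_on (closure X) U" "\<And>x. x \<in> X \<Longrightarrow> u x = U x"
    by (rule uniformly_continuous_on_extension_on_closure) (rule that, assumption, blast)
  have cX: "closure X = UNIV" using dense by (simp add: X_def)
  have lim: "(\<lambda>n. U (s n)) \<longlonglongrightarrow> U x" if "s \<longlonglongrightarrow> x" for s x
    using uniformly_continuous_imp_continuous[OF U(1)] that unfolding cX
    by (intro isCont_tendsto_compose[of x U]) (auto simp: continuous_on_eq_continuous_at)
  have "inner (U x) (U y) = inner x y" for x y
  proof -
    obtain s t where s: "\<And>n. s n \<in> X" "s \<longlonglongrightarrow> x" and t: "\<And>n. t n \<in> X" "t \<longlonglongrightarrow> y"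
      using cX closure_sequential[of x X] closure_sequential[of y X] by auto
    have "(\<lambda>n. inner (U (s n)) (U (t n))) \<longlonglongrightarrow> inner (U x) (U y)"
      by (intro tendsto_inner lim s t)
    moreover have "(\<lambda>n. inner (U (s n)) (U (t n))) = (\<lambda>n. inner (s n) (t n))"
      using s(1) t(1) by (simp add: U(2)[symmetric] u)
    moreover have "(\<lambda>n. inner (s n) (t n)) \<longlonglongrightarrow> inner x y" by (intro tendsto_inner s t)
    ultimately show ?thesis by (metis LIMSEQ_unique)
  qed
  moreover have "U (e i) = e' i" for i
    using U(2)[of "e i"] ue[of i] by (simp add: X_def span_base)
  ultimately show ?thesis by blast
qed

lemma dense_span_induct:
  fixes S :: "'a::real_inner set"
  assumes "closure (span S) = UNIV" "closed {x. P x}" "P 0"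
    "\<And>x y. P x \<Longrightarrow> P y \<Longrightarrow> P (x + y)" "\<And>c s. s \<in> S \<Longrightarrow> P (c *\<^sub>R s)"
  shows "P x"
proof -
  have "span S \<subseteq> {x. P x}"
  proof
    fix x assume "x \<in> span S"
    then show "x \<in> {x. P x}"
      by (induction rule: span_induct_alt) (use assms in auto)
  qed
  then have "closure (span S) \<subseteq> {x. P x}" using assms(2) by (rule closure_minimal)
  then show ?thesis using assms(1) by auto
qed

section \<open>Completeness of Fock space and totality of the exponential vectors\<close>

lemma coord_simps [simp]:
  "coord 0 xs = 0" "coord (f + g) xs = coord f xs + coord g xs"
  "coord (c *\<^sub>C f) xs = c * coord f xs" "coord (r *\<^sub>R f) xs = complex_of_real r * coord f xs"
  "coord (- f) xs = - coord f xs" "coord (f - g) xs = coord f xs - coord g xs"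
  by (simp_all add: zero_fock.rep_eq plus_fock.rep_eq scaleC.rep_eq scaleR_fock_def
      uminus_fock_def minus_fock_def)

lemma coord_sum: "coord (sum h F) xs = (\<Sum>i\<in>F. coord (h i) xs)"
  by (induction F rule: infinite_finite_induct) simp_all

lemma fock_eqI: "(\<And>xs. coord f xs = coord g xs) \<Longrightarrow> f = g"
  by (simp add: coord_inject[symmetric] fun_eq_iff)

lemma norm_fock_sq: "(norm f)\<^sup>2 = (\<Sum>\<^sub>\<infinity>xs. (norm (coord f xs))\<^sup>2)"
  by (simp add: power2_norm_eq_inner inner_fock_def cinner_self)

lemma sum_coord_sq_le: "finite F \<Longrightarrow> (\<Sum>xs\<in>F. (norm (coord f xs))\<^sup>2) \<le> (norm f)\<^sup>2"
  unfolding norm_fock_sq by (rule finite_sum_le_infsum[OF coord_sq_summable]) auto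

lemma norm_coord_le: "norm (coord f xs) \<le> norm f"
  using sum_coord_sq_le[of "{xs}" f] by (simp add: power2_le_iff_abs_le)

instance fock :: (finite) complete_space
proof
  fix X :: "nat \<Rightarrow> 'a fock" assume X: "Cauchy X"
  have "Cauchy (\<lambda>n. coord (X n) xs)" for xs
  proof (rule metric_CauchyI)
    fix e :: real assume "0 < e"
    then obtain N where N: "\<And>m n. N \<le> m \<Longrightarrow> N \<le> n \<Longrightarrow> dist (X m) (X n) < e"
      using metric_CauchyD[OF X] by metis
    have "dist (coord (X m) xs) (coord (X n) xs) \<le> dist (X m) (X n)" for m n
      using norm_coord_le[of "X m - X n" xs] by (simp add: dist_norm)
    then show "\<exists>M. \<forall>m\<ge>M. \<forall>n\<ge>M. dist (coord (X m) xs) (coord (X n) xs) < e"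
      using N le_less_trans by blast
  qed
  then have "convergent (\<lambda>n. coord (X n) xs)" for xs by (rule Cauchy_convergent)
  then obtain a where a: "\<And>xs. (\<lambda>n. coord (X n) xs) \<longlonglongrightarrow> a xs"
    unfolding convergent_def by metis
  \<comment> \<open>The bound is uniform in the finite set \<open>F\<close>, so it survives in the
    full sum of squares; for fixed \<open>F\<close> the limit over \<open>m\<close> is taken
    termwise.\<close>
  have est: "\<exists>N. \<forall>n\<ge>N. \<forall>F. finite F \<longrightarrow> (\<Sum>xs\<in>F. (norm (coord (X n) xs - a xs))\<^sup>2) \<le> e\<^sup>2"
    if e: "0 < e" for e
  proof -
    obtain N where N: "\<And>m n. N \<le> m \<Longrightarrow> N \<le> n \<Longrightarrow> dist (X m) (X n) < e"
      using metric_CauchyD[OF X e] by metis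
    have "(\<Sum>xs\<in>F. (norm (coord (X n) xs - a xs))\<^sup>2) \<le> e\<^sup>2" if "N \<le> n" "finite F" for n F
    proof (rule LIMSEQ_le_const2)
      show "(\<lambda>m. \<Sum>xs\<in>F. (norm (coord (X n) xs - coord (X m) xs))\<^sup>2)
              \<longlonglongrightarrow> (\<Sum>xs\<in>F. (norm (coord (X n) xs - a xs))\<^sup>2)"
        by (intro tendsto_intros a)
      have "(\<Sum>xs\<in>F. (norm (coord (X n) xs - coord (X m) xs))\<^sup>2) \<le> e\<^sup>2" if "N \<le> m" for m
      proof -
        have "(norm (X n - X m))\<^sup>2 \<le> e\<^sup>2"
          using N[OF \<open>N \<le> n\<close> that] by (intro power_mono) (auto simp: dist_norm)
        then show ?thesis using sum_coord_sq_le[OF \<open>finite F\<close>, of "X n - X m"] by simp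
      qed
      then show "\<exists>N. \<forall>m\<ge>N. (\<Sum>xs\<in>F. (norm (coord (X n) xs - coord (X m) xs))\<^sup>2) \<le> e\<^sup>2" by blast
    qed
    then show ?thesis by blast
  qed
  have summ: "(\<lambda>xs. (norm (coord (X n) xs - a xs))\<^sup>2) summable_on UNIV"
    if "\<And>F. finite F \<Longrightarrow> (\<Sum>xs\<in>F. (norm (coord (X n) xs - a xs))\<^sup>2) \<le> e" for n e
    by (rule nonneg_bdd_above_summable_on) (use that in \<open>auto intro!: bdd_aboveI[of _ e]\<close>)
  have sym: "a xs = a ys" if "mset xs = mset ys" for xs ys
    by (rule LIMSEQ_unique[OF a]) (use a[of ys] sym_l2_D(1)[OF coord that] in simp)
  obtain N where N: "\<And>F. finite F \<Longrightarrow> (\<Sum>xs\<in>F. (norm (coord (X N) xs - a xs))\<^sup>2) \<le> 1\<^sup>2"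
    using est[of 1] by auto
  \<comment> \<open>\<open>a\<close> is recovered as \<open>X N\<close> minus the square-summable
    difference \<open>X N - a\<close>.\<close>
  have "(\<lambda>xs. (norm (coord (X N) xs + (-1) * (coord (X N) xs - a xs)))\<^sup>2) summable_on UNIV"
    by (intro l2_add l2_scale coord_sq_summable summ[of N, OF N])
  then have aS: "a \<in> sym_l2" by (intro sym_l2_I sym) simp_all
  define f where "f = Abs_fock a"
  have cf: "coord f = a" by (simp add: f_def Abs_fock_inverse[OF aS])
  have "X \<longlonglongrightarrow> f"
  proof (rule metric_LIMSEQ_I)
    fix r :: real assume r: "0 < r"
    then obtain N where N: "\<And>n F. N \<le> n \<Longrightarrow> finite F \<Longrightarrow>
        (\<Sum>xs\<in>F. (norm (coord (X n) xs - a xs))\<^sup>2) \<le> (r / 2)\<^sup>2"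
      using est[of "r / 2"] by auto
    have "dist (X n) f < r" if "N \<le> n" for n
    proof -
      have "(norm (X n - f))\<^sup>2 \<le> (r / 2)\<^sup>2"
        unfolding norm_fock_sq
        by (rule infsum_le_finite_sums[OF coord_sq_summable]) (use N[OF that] cf in simp)
      then have "norm (X n - f) \<le> r / 2" by (rule power2_le_imp_le) (use r in simp)
      then show ?thesis using r by (simp add: dist_norm)
    qed
    then show "\<exists>N. \<forall>n\<ge>N. dist (X n) f < r" by blast
  qed
  then show "convergent X" by (auto simp: convergent_def)
qed

section \<open>Calculus of the complex inner product\<close>

lemma cinner_add_right: "cinner h (f + g) = cinner h f + cinner h g"
  by (subst (1 2 3) cinner_commute) (simp add: cinner_add_left)

lemma cinner_scaleC_right: "cinner g (c *\<^sub>C f) = c * cinner g f"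
  by (subst (1 2) cinner_commute) (simp add: cinner_scaleC_left)

lemma scaleR_eq_scaleC: "r *\<^sub>R f = complex_of_real r *\<^sub>C f"
  by (simp add: scaleR_fock_def)

lemma cinner_minus_left: "cinner (- f) g = - cinner f g"
  by (simp add: uminus_fock_def cinner_scaleC_left)

lemma cinner_minus_right: "cinner g (- f) = - cinner g f"
  by (simp add: uminus_fock_def cinner_scaleC_right)

lemma cinner_diff_left: "cinner (f - g) h = cinner f h - cinner g h"
  unfolding minus_fock_def cinner_add_left cinner_minus_left by simp

lemma cinner_diff_right: "cinner h (f - g) = cinner h f - cinner h g"
  unfolding minus_fock_def cinner_add_right cinner_minus_right by simp

lemma cinner_zero [simp]: "cinner 0 f = 0" "cinner f 0 = 0"
  by (simp_all add: cinner_def)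

lemmas cinner_simps = cinner_add_left cinner_add_right cinner_scaleC_left cinner_scaleC_right
  cinner_diff_left cinner_diff_right cinner_minus_left cinner_minus_right

lemma cinner_eq_Complex_inner: "cinner f g = Complex (inner f g) (inner (\<i> *\<^sub>C f) g)"
  by (rule complex_eqI) (simp_all add: inner_fock_def cinner_scaleC_left)

lemma cinner_self_norm: "cinner f f = complex_of_real ((norm f)\<^sup>2)"
  by (simp add: cinner_self norm_fock_sq)

lemma norm_scaleC: "norm (c *\<^sub>C f) = norm c * norm f"
proof -
  have "complex_of_real ((norm (c *\<^sub>C f))\<^sup>2) = complex_of_real ((norm c * norm f)\<^sup>2)"
    unfolding cinner_self_norm[symmetric] cinner_simps
    using complex_norm_square[of c] by (simp add: cinner_self_norm power_mult_distrib mult.assoc[symmetric] mult.commute)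
  then show ?thesis by (simp add: power2_eq_iff_nonneg del: of_real_power of_real_mult)
qed

lemma norm_cinner_le: "norm (cinner f g) \<le> norm f * norm g"
proof -
  \<comment> \<open>Rotating \<open>g\<close> by this phase makes the inner product real and
    nonnegative, so the real Cauchy-Schwarz inequality applies.\<close>
  define w where "w = cnj (sgn (cinner f g))"
  have "cinner f (w *\<^sub>C g) = complex_of_real (norm (cinner f g))"
    by (cases "cinner f g = 0")
      (auto simp: cinner_simps w_def sgn_div_norm complex_norm_square[symmetric] scaleR_conv_of_real
        power2_eq_square mult.commute field_simps simp flip: of_real_mult)
  then have "norm (cinner f g) = inner f (w *\<^sub>C g)" by (simp add: inner_fock_def)
  also have "\<dots> \<le> norm f * norm (w *\<^sub>C g)" by (rule norm_cauchy_schwarz)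
  also have "\<dots> \<le> norm f * norm g"
    by (intro mult_left_mono) (auto simp: norm_scaleC w_def norm_sgn)
  finally show ?thesis .
qed

lemma bounded_linear_scaleC: "bounded_linear (\<lambda>f :: 'n::finite fock. c *\<^sub>C f)"
  by (rule bounded_linear_intro[of _ "norm c"]) (auto intro!: fock_eqI simp: norm_scaleC algebra_simps)

lemmas tendsto_scaleC [tendsto_intros] = bounded_linear.tendsto[OF bounded_linear_scaleC]

lemma tendsto_cinner [tendsto_intros]:
  assumes "(f \<longlongrightarrow> a) F" "(g \<longlongrightarrow> b) F"
  shows "((\<lambda>x. cinner (f x) (g x)) \<longlongrightarrow> cinner a b) F"
  unfolding cinner_eq_Complex_inner Complex_eq by (intro tendsto_intros assms)

lemma bounded_linear_cinner_right: "bounded_linear (\<lambda>g. cinner f g)"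
  by (rule bounded_linear_intro[of _ "norm f"])
    (auto simp: cinner_simps scaleR_eq_scaleC scaleR_conv_of_real norm_cinner_le mult.commute[of "norm _" "norm f"])

lemma cinner_sum_left: "cinner (\<Sum>x\<in>A. f x) g = (\<Sum>x\<in>A. cinner (f x) g)"
  by (induction A rule: infinite_finite_induct) (simp_all add: cinner_simps)

lemma cinner_sum_right: "cinner g (\<Sum>x\<in>A. f x) = (\<Sum>x\<in>A. cinner g (f x))"
  by (induction A rule: infinite_finite_induct) (simp_all add: cinner_simps)

lemma closure_cspan_eq_UNIV:
  fixes S :: "'n::finite fock set"
  assumes "\<And>f. (\<And>s. s \<in> S \<Longrightarrow> cinner s f = 0) \<Longrightarrow> f = 0"
  shows "closure (span {c *\<^sub>C s |c s. s \<in> S}) = UNIV"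
proof (rule closure_span_eq_UNIV)
  fix f assume f: "\<And>s. s \<in> {c *\<^sub>C s |c s. s \<in> S} \<Longrightarrow> inner f s = 0"
  show "f = 0"
  proof (rule assms)
    fix s assume s: "s \<in> S"
    have "inner f (1 *\<^sub>C s) = 0" "inner f (\<i> *\<^sub>C s) = 0" using f s by blast+
    then show "cinner s f = 0"
      by (subst cinner_commute) (simp add: inner_fock_def cinner_simps complex_eq_iff)
  qed
qed

section \<open>Gram matrix and totality of the exponential vectors\<close>

lemma has_sum_group:
  fixes f :: "'a \<Rightarrow> 'b::{topological_comm_monoid_add, t3_space}"
  assumes "(f has_sum s) UNIV" "\<And>k. finite {x. p x = k}"
  shows "((\<lambda>k. \<Sum>x | p x = k. f x) has_sum s) UNIV"
proof (rule has_sum_SigmaD)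
  show "((\<lambda>(k, x). f x) has_sum s) (SIGMA k:UNIV. {x. p x = k})"
    using assms(1)
    by (rule has_sum_reindex_bij_witness[of _ "\<lambda>x. (p x, x)" snd, THEN iffD2, rotated -1]) auto
qed (use assms(2) in auto)

lemma finite_words: "finite {xs :: 'n::finite list. length xs = r}"
  using finite_lists_length_eq[of "UNIV :: 'n set" r] by simp

lemma sum_words_prod_list_comm:
  fixes a :: "'n::finite \<Rightarrow> 'b::comm_semiring_1"
  shows "(\<Sum>xs | length xs = r. prod_list (map a xs)) = (\<Sum>i\<in>UNIV. a i) ^ r"
proof (induction r)
  case (Suc r)
  have eq: "{xs :: 'n list. length xs = Suc r} = (\<lambda>(i, xs). i # xs) ` (UNIV \<times> {xs. length xs = r})"
    by (auto simp: length_Suc_conv image_iff)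
  have "(\<Sum>xs | length xs = Suc r. prod_list (map a xs)) =
        (\<Sum>(i, xs)\<in>UNIV \<times> {xs. length xs = r}. a i * prod_list (map a xs))"
    unfolding eq by (subst sum.reindex) (auto simp: inj_on_def case_prod_unfold)
  also have "\<dots> = (\<Sum>i\<in>UNIV. a i) * (\<Sum>xs | length xs = r. prod_list (map a xs))"
    by (simp add: sum.cartesian_product[symmetric] sum_product)
  finally show ?case by (simp add: Suc.IH)
qed simp

text \<open>The words of length \<open>r\<close> together contribute
  \<open>cdot v w ^ r / fact r\<close>, so grouping by length produces the exponential
  series.\<close>

lemma cinner_expvec: "cinner (expvec v) (expvec w) = exp (cdot v w)"
proof -
  define a where "a i = cnj (v $ i) * w $ i" for i
  have c: "cnj (coord (expvec v) xs) * coord (expvec w) xs = prod_list (map a xs) / fact (length xs)" for xs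
  proof -
    have "cnj (prod_list (map (($) v) xs)) * prod_list (map (($) w) xs) = prod_list (map a xs)"
      by (induction xs) (simp_all add: a_def)
    moreover have "complex_of_real (sqrt (fact n)) * complex_of_real (sqrt (fact n)) = fact n" for n
      by (simp flip: of_real_mult)
    ultimately show ?thesis by (simp add: expvec.rep_eq)
  qed
  have "((\<lambda>xs. prod_list (map a xs) / fact (length xs)) has_sum cinner (expvec v) (expvec w)) UNIV"
    unfolding c[symmetric] cinner_def by (rule has_sum_infsum[OF cinner_summable])
  then have "((\<lambda>r. \<Sum>xs | length xs = r. prod_list (map a xs) / fact (length xs))
      has_sum cinner (expvec v) (expvec w)) UNIV"
    by (rule has_sum_group) (rule finite_words)
  moreover have "(\<Sum>xs | length xs = r. prod_list (map a xs) / fact (length xs)) = cdot v w ^ r / fact r" for r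
    unfolding cdot_def a_def[symmetric] sum_words_prod_list_comm[symmetric] sum_divide_distrib
    by (rule sum.cong) auto
  ultimately have "(\<lambda>r. cdot v w ^ r / fact r) sums cinner (expvec v) (expvec w)"
    by (simp add: has_sum_imp_sums)
  moreover have "(\<lambda>r. cdot v w ^ r / fact r) sums exp (cdot v w)"
    using exp_converges[of "cdot v w"] by (simp add: scaleR_conv_of_real divide_inverse mult.commute)
  ultimately show ?thesis by (rule sums_unique2)
qed

text \<open>Once all lower coefficients vanish, dividing by \<open>t ^ r\<close> and letting
  \<open>t\<close> tend to 0 isolates \<open>a r\<close>.\<close>

lemma powser_eq_zero_imp_coeff_eq_zero:
  fixes a :: "nat \<Rightarrow> complex"
  assumes "\<And>t. (\<lambda>n. a n * t ^ n) sums 0"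
  shows "a r = 0"
proof (induction r rule: less_induct)
  case (less r)
  have sm: "(\<lambda>n. a (n + r) * t ^ n) sums 0" if t: "t \<noteq> 0" for t
  proof -
    have "(\<lambda>n. a (n + r) * t ^ (n + r)) sums (0 - (\<Sum>n<r. a n * t ^ n))"
      using assms[of t] by (rule sums_split_initial_segment)
    then have "(\<lambda>n. a (n + r) * t ^ (n + r)) sums 0" using less by simp
    then have "(\<lambda>n. a (n + r) * t ^ (n + r) / t ^ r) sums (0 / t ^ r)" by (rule sums_divide)
    then show ?thesis using t by (simp add: power_add)
  qed
  have "((\<lambda>_. 0) \<longlongrightarrow> a (0 + r)) (at (0 :: complex))"
    by (rule powser_limit_0_strong[where s = 1 and a = "\<lambda>n. a (n + r)"]) (auto intro: sm)
  then show ?case by (simp add: tendsto_const_iff)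
qed

lemma digits_unique:
  fixes c d :: "nat \<Rightarrow> nat"
  assumes "\<And>j. c j < B" "\<And>j. d j < B" "(\<Sum>j<n. c j * B ^ j) = (\<Sum>j<n. d j * B ^ j)" "j < n"
  shows "c j = d j"
  using assms
proof (induction n arbitrary: c d j)
  case (Suc n)
  have split: "(\<Sum>j<Suc n. h j * B ^ j) = h 0 + B * (\<Sum>j<n. h (Suc j) * B ^ j)" for h :: "nat \<Rightarrow> nat"
    by (subst sum.lessThan_Suc_shift) (simp add: sum_distrib_left mult_ac)
  have eq: "c 0 + B * (\<Sum>j<n. c (Suc j) * B ^ j) = d 0 + B * (\<Sum>j<n. d (Suc j) * B ^ j)"
    using Suc.prems(3) unfolding split .
  have "c 0 = d 0" using arg_cong[OF eq, of "\<lambda>x. x mod B"] Suc.prems(1,2) by simp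
  moreover have "(\<Sum>j<n. c (Suc j) * B ^ j) = (\<Sum>j<n. d (Suc j) * B ^ j)"
    using eq \<open>c 0 = d 0\<close> Suc.prems(1)[of 0] by simp
  then have "c (Suc i) = d (Suc i)" if "i < n" for i
    using Suc.IH[of "\<lambda>j. c (Suc j)" "\<lambda>j. d (Suc j)" i] Suc.prems(1,2) that by simp
  ultimately show ?case using Suc.prems(4) by (cases j) auto
qed simp

text \<open>Substituting \<open>t ^ (B ^ j)\<close> for the \<open>j\<close>-th variable turns distinct monomials of
  degree below \<open>B\<close> into distinct powers of \<open>t\<close>.\<close>

lemma symmetric_form_eq_zero:
  fixes g :: "'n::finite list \<Rightarrow> complex"
  assumes sym: "\<And>xs ys. mset xs = mset ys \<Longrightarrow> g xs = g ys"
    and zero: "\<And>v. (\<Sum>xs | length xs = r. g xs * prod_list (map v xs)) = 0"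
    and len: "length ys = r"
  shows "g ys = 0"
proof -
  obtain ix :: "'n \<Rightarrow> nat" where ix: "bij_betw ix UNIV {..<CARD('n)}"
    using ex_bij_betw_finite_nat[of "UNIV :: 'n set"] by (auto simp: atLeast0LessThan)
  \<comment> \<open>A word of length \<open>r\<close> uses a letter at most \<open>r\<close> times,
    so in base \<open>Suc r\<close> the multiplicities are the digits of \<open>d xs\<close>, and
    \<open>d xs\<close> determines the multiset.\<close>
  define d where "d xs = sum_list (map (\<lambda>i. Suc r ^ ix i) xs)" for xs :: "'n list"
  have dcount: "d xs = (\<Sum>j<CARD('n). count (mset xs) (inv_into UNIV ix j) * Suc r ^ j)" for xs
  proof -
    have "d xs = (\<Sum>i\<in>UNIV. count (mset xs) i * Suc r ^ ix i)"
      unfolding d_def sum_list_map_eq_sum_count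
      by (rule sum.mono_neutral_cong_left) (auto simp: count_mset count_list_0_iff)
    also have "\<dots> = (\<Sum>j<CARD('n). count (mset xs) (inv_into UNIV ix j) * Suc r ^ j)"
      by (subst sum.reindex_bij_betw[OF ix, symmetric])
        (simp add: inv_into_f_f[OF bij_betw_imp_inj_on[OF ix]])
    finally show ?thesis .
  qed
  have inj: "mset xs = mset ys" if "length xs = r" "d xs = d ys" for xs
  proof (rule multiset_eqI)
    fix i
    have "count (mset zs) k < Suc r" if "length zs = r" for zs :: "'n list" and k
      using count_le_size[of "mset zs" k] that by (simp add: less_Suc_eq_le)
    then have "count (mset xs) (inv_into UNIV ix (ix i)) = count (mset ys) (inv_into UNIV ix (ix i))"
      using that len ix by (intro digits_unique[where B = "Suc r" and n = "CARD('n)" and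
            c = "\<lambda>j. count (mset xs) (inv_into UNIV ix j)" and
            d = "\<lambda>j. count (mset ys) (inv_into UNIV ix j)"])
        (auto simp: dcount[symmetric] bij_betw_def)
    then show "count (mset xs) i = count (mset ys) i"
      by (simp add: inv_into_f_f[OF bij_betw_imp_inj_on[OF ix]])
  qed
  define p where "p = (\<Sum>xs | length xs = r. monom (g xs) (d xs))"
  have "poly p t = 0" for t
  proof -
    have "prod_list (map (\<lambda>i. t ^ (Suc r ^ ix i)) xs) = t ^ d xs" for xs
      by (induction xs) (simp_all add: d_def power_add)
    then show ?thesis
      using zero[of "\<lambda>i. t ^ (Suc r ^ ix i)"] by (simp add: p_def poly_sum poly_monom)
  qed
  then have "p = 0" using poly_all_0_iff_0 by blast
  then have "0 = (\<Sum>xs | length xs = r. if d xs = d ys then g xs else 0)"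
    using coeff_sum[of "\<lambda>xs. monom (g xs) (d xs)" "{xs. length xs = r}" "d ys"] by (simp add: p_def)
  also have "\<dots> = (\<Sum>xs\<in>{xs. length xs = r} \<inter> {xs. d xs = d ys}. g xs)"
    by (subst sum.inter_restrict[OF finite_words]) simp
  also have "\<dots> = (\<Sum>xs\<in>{xs. length xs = r} \<inter> {xs. d xs = d ys}. g ys)"
    by (rule sum.cong) (auto intro: sym inj)
  \<comment> \<open>The coefficient of \<open>p\<close> at degree \<open>d ys\<close> collects
    exactly the rearrangements of \<open>ys\<close>, all with the same value of
    \<open>g\<close>.\<close>
  finally have "of_nat (card ({xs. length xs = r} \<inter> {xs. d xs = d ys})) * g ys = 0" by simp
  moreover have "ys \<in> {xs. length xs = r} \<inter> {xs. d xs = d ys}" using len by simp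
  then have "card ({xs. length xs = r} \<inter> {xs. d xs = d ys}) \<noteq> 0"
    using finite_words by (metis card_0_eq empty_iff finite_Int)
  ultimately show ?thesis by simp
qed

text \<open>Orthogonality to \<open>expvec (t *s v)\<close> for all \<open>t\<close> is a vanishing
  power series in \<open>t\<close>, which isolates the homogeneous components of \<open>f\<close>;
  each is a symmetric form vanishing at every \<open>v\<close>.\<close>

lemma expvec_total:
  assumes "\<And>v. cinner (expvec v) f = 0"
  shows "f = 0"
proof (rule fock_eqI)
  fix ys
  \<comment> \<open>Conjugating \<open>f\<close> instead of \<open>v\<close> makes the pairing
    polynomial in \<open>v\<close> for each word length.\<close>
  define g where "g xs = cnj (coord f xs) / complex_of_real (sqrt (fact (length xs)))" for xs
  define h where "h v r = (\<Sum>xs | length xs = r. g xs * prod_list (map (($) v) xs))" for v r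
  have hs: "(h v has_sum 0) UNIV" for v
  proof -
    have "((\<lambda>xs. cnj (coord f xs) * coord (expvec v) xs) has_sum cinner f (expvec v)) UNIV"
      unfolding cinner_def by (rule has_sum_infsum[OF cinner_summable])
    moreover have "cinner f (expvec v) = 0" using assms[of v] by (subst cinner_commute) simp
    moreover have "(\<lambda>xs. cnj (coord f xs) * coord (expvec v) xs) = (\<lambda>xs. g xs * prod_list (map (($) v) xs))"
      by (simp add: fun_eq_iff g_def expvec.rep_eq)
    ultimately have "((\<lambda>xs. g xs * prod_list (map (($) v) xs)) has_sum 0) UNIV" by simp
    then show ?thesis unfolding h_def by (rule has_sum_group) (rule finite_words)
  qed
  have hz: "h v r = 0" for v r
  proof (rule powser_eq_zero_imp_coeff_eq_zero)
    fix t :: complex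
    have "prod_list (map (($) (t *s v)) xs) = prod_list (map (($) v) xs) * t ^ length xs" for xs
      by (induction xs) simp_all
    then have "h (t *s v) = (\<lambda>n. h v n * t ^ n)"
      unfolding h_def sum_distrib_right by (intro ext sum.cong) auto
    then show "(\<lambda>n. h v n * t ^ n) sums 0" using has_sum_imp_sums[OF hs[of "t *s v"]] by simp
  qed
  have "g ys = 0"
  proof (rule symmetric_form_eq_zero[of g "length ys"])
    show "g xs = g zs" if "mset xs = mset zs" for xs zs
      using sym_l2_D(1)[OF coord that] mset_eq_length[OF that] by (simp add: g_def)
    show "(\<Sum>xs | length xs = length ys. g xs * prod_list (map v xs)) = 0" for v
    proof -
      have "($) (vec_lambda v) = v" by (rule ext) simp
      then show ?thesis using hz[of "vec_lambda v" "length ys"] by (simp add: h_def)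
    qed
  qed simp
  then show "coord f ys = coord 0 ys" by (simp add: g_def)
qed

lemma closure_cspan_expvec:
  "closure (span {c *\<^sub>C s |c s. s \<in> range (expvec :: _ \<Rightarrow> 'n::finite fock)}) = UNIV"
  by (rule closure_cspan_eq_UNIV) (auto intro: expvec_total)

section \<open>Weyl operators and orthonormal expansions\<close>

lemma expvec_induct:
  fixes f :: "'n::finite fock"
  assumes "closed {f. P f}" "\<And>f g. P f \<Longrightarrow> P g \<Longrightarrow> P (f + g)" "\<And>c v. P (c *\<^sub>C expvec v)"
  shows "P f"
proof (rule dense_span_induct[OF closure_cspan_expvec assms(1)])
  have "0 *\<^sub>C expvec 0 = (0 :: 'n fock)" by (rule fock_eqI) simp
  then show "P 0" using assms(3)[of 0 0] by simp
  have "r *\<^sub>R (c *\<^sub>C s) = (r * c) *\<^sub>C s" for r c and s :: "'n fock" by (rule fock_eqI) simp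
  then show "P (r *\<^sub>R s)" if "s \<in> {c *\<^sub>C s |c s. s \<in> range expvec}" for r s
    using assms(3) that by force
qed (rule assms(2))

lemma bounded_clinearD:
  assumes "bounded_clinear A"
  shows "A (f + g) = A f + A g" "A (c *\<^sub>C f) = c *\<^sub>C A f" "A (f - g) = A f - A g" "A 0 = 0"
    "A (sum h I) = (\<Sum>i\<in>I. A (h i))" "(X \<longlongrightarrow> f) F \<Longrightarrow> ((\<lambda>x. A (X x)) \<longlongrightarrow> A f) F"
proof -
  have A: "bounded_linear A" "A (c *\<^sub>C f) = c *\<^sub>C A f" using assms by (auto simp: bounded_clinear_def)
  interpret bounded_linear A by (rule A)
  show "A (f + g) = A f + A g" "A (c *\<^sub>C f) = c *\<^sub>C A f" "A (f - g) = A f - A g" "A 0 = 0"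
    "A (sum h I) = (\<Sum>i\<in>I. A (h i))"
    by (simp_all add: add A(2) diff zero sum)
  show "(X \<longlongrightarrow> f) F \<Longrightarrow> ((\<lambda>x. A (X x)) \<longlongrightarrow> A f) F" by (rule tendsto)
qed

lemma bounded_clinear_comp:
  assumes "bounded_clinear A" "bounded_clinear B"
  shows "bounded_clinear (A \<circ> B)"
  using assms unfolding bounded_clinear_def o_def by (auto intro: bounded_linear_compose)

lemma bounded_clinear_eq_onI:
  assumes A: "bounded_clinear A" and B: "bounded_clinear B"
    and "\<And>v. A (expvec v) = B (expvec v)"
  shows "A f = B f"
proof (rule expvec_induct[of "\<lambda>f. A f = B f"])
  show "closed {f. A f = B f}"
    using A B by (intro closed_Collect_eq linear_continuous_on) (auto simp: bounded_clinear_def)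
qed (simp_all add: bounded_clinearD[OF A] bounded_clinearD[OF B] assms(3))

lemma cinner_preserving_imp_bounded_clinear:
  assumes U: "\<And>f g. cinner (U f) (U g) = cinner f g"
  shows "bounded_clinear U"
proof -
  have "norm (U (c *\<^sub>C f) - c *\<^sub>C U f) ^ 2 = norm (c *\<^sub>C f - c *\<^sub>C f) ^ 2" for c f
    unfolding power2_norm_eq_inner inner_fock_def by (simp add: cinner_simps U)
  then show ?thesis
    unfolding bounded_clinear_def
    by (intro conjI inner_preserving_imp_linear) (simp_all add: inner_fock_def U)
qed

lemma cnj_cdot: "cnj (cdot u v) = cdot v u"
  by (simp add: cdot_def mult.commute)

lemma cdot_add: "cdot (u + v) w = cdot u w + cdot v w" "cdot w (u + v) = cdot w u + cdot w v"
  by (simp_all add: cdot_def distrib_left distrib_right sum.distrib)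

lemma cdot_minus: "cdot (- u) w = - cdot u w" "cdot w (- u) = - cdot w u"
  by (simp_all add: cdot_def sum_negf)

lemma cdot_diff: "cdot (u - v) w = cdot u w - cdot v w" "cdot w (u - v) = cdot w u - cdot w v"
  by (simp_all add: cdot_def left_diff_distrib right_diff_distrib sum_subtractf)

lemma cdot_self: "cdot u u = complex_of_real ((norm u)\<^sup>2)"
proof -
  have "(norm u)\<^sup>2 = (\<Sum>i\<in>UNIV. (norm (u $ i))\<^sup>2)"
    by (simp add: norm_vec_def L2_set_def sum_nonneg)
  moreover have "cdot u u = (\<Sum>i\<in>UNIV. complex_of_real ((norm (u $ i))\<^sup>2))"
    unfolding cdot_def by (intro sum.cong) (auto simp: complex_norm_square mult.commute simp del: of_real_power)
  ultimately show ?thesis by simp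
qed

definition weyl_phase :: "complex ^ 'n::finite \<Rightarrow> complex ^ 'n \<Rightarrow> complex" where
  "weyl_phase u v = exp (- complex_of_real ((norm u)\<^sup>2 / 2) - cdot u v)"

text \<open>The scalar in the definition of \<open>weyl\<close> is exactly what restores the Gram
  matrix of the exponential vectors after translation by \<open>u\<close>.\<close>

lemma weyl_phase_gram:
  "cnj (weyl_phase u v) * weyl_phase u w * cinner (expvec (u + v)) (expvec (u + w))
     = cinner (expvec v) (expvec w)"
  unfolding weyl_phase_def cinner_expvec exp_cnj mult_exp_exp
  by (simp add: cnj_cdot cdot_add cdot_self)

lemma ex_weyl:
  fixes u :: "complex ^ 'n::finite"
  shows "\<exists>U. (\<forall>f g. cinner (U f) (U g) = cinner f g) \<and> (\<forall>v. U (expvec v) = weyl_phase u v *\<^sub>C expvec (u + v))"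
proof -
  \<comment> \<open>Complex multiples are put into the index family because
    \<open>ex_isometry\<close> works with real spans and real inner products.\<close>
  define e :: "complex \<times> (complex ^ 'n) \<Rightarrow> 'n fock" where "e = (\<lambda>(c, v). c *\<^sub>C expvec v)"
  define e' :: "complex \<times> (complex ^ 'n) \<Rightarrow> 'n fock"
    where "e' = (\<lambda>(c, v). c *\<^sub>C weyl_phase u v *\<^sub>C expvec (u + v))"
  have gram: "cinner (e' i) (e' j) = cinner (e i) (e j)" for i j
    using arg_cong[OF weyl_phase_gram[of u "snd i" "snd j"], of "\<lambda>x. cnj (fst i) * fst j * x"]
    by (simp add: e_def e'_def case_prod_unfold cinner_simps mult_ac)
  have re: "range e = {c *\<^sub>C s |c s. s \<in> range expvec}" by (auto simp: e_def image_iff)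
  have "\<exists>U. (\<forall>x y. inner (U x) (U y) = inner x y) \<and> (\<forall>i. U (e i) = e' i)"
    by (rule ex_isometry) (simp_all add: re closure_cspan_expvec inner_fock_def gram)
  then obtain U where U: "\<And>x y. inner (U x) (U y) = inner x y" "\<And>i. U (e i) = e' i" by blast
  have lin: "bounded_linear U" by (rule inner_preserving_imp_linear) (rule U(1))
  then interpret bounded_linear U .
  \<comment> \<open>Complex linearity upgrades preservation of \<open>inner\<close> to preservation
    of \<open>cinner\<close>, whose imaginary part is the real inner product with
    \<open>\<i> *\<^sub>C f\<close>.\<close>
  have Uc: "U (c *\<^sub>C f) = c *\<^sub>C U f" for c f
  proof (rule expvec_induct[of "\<lambda>f. U (c *\<^sub>C f) = c *\<^sub>C U f"])
    show "closed {f. U (c *\<^sub>C f) = c *\<^sub>C U f}"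
      by (intro closed_Collect_eq bounded_linear.continuous_on[OF bounded_linear_scaleC] bounded_linear.continuous_on[OF lin]
          continuous_on_id)
  next
    fix f g assume *: "U (c *\<^sub>C f) = c *\<^sub>C U f" "U (c *\<^sub>C g) = c *\<^sub>C U g"
    have d: "c *\<^sub>C (f + g) = c *\<^sub>C f + c *\<^sub>C g" for f g :: "'n fock"
      by (rule fock_eqI) (simp add: algebra_simps)
    show "U (c *\<^sub>C (f + g)) = c *\<^sub>C U (f + g)" by (simp add: d add *)
  next
    fix d v
    have m: "c *\<^sub>C d *\<^sub>C f = (c * d) *\<^sub>C f" for c d and f :: "'n fock"
      by (rule fock_eqI) (simp add: mult_ac)
    show "U (c *\<^sub>C d *\<^sub>C expvec v) = c *\<^sub>C U (d *\<^sub>C expvec v)"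
      using U(2)[of "(c * d, v)"] U(2)[of "(d, v)"] by (simp add: m e_def e'_def mult.assoc)
  qed
  have "cinner (U f) (U g) = cinner f g" for f g
    unfolding cinner_eq_Complex_inner Uc[symmetric] U(1) ..
  moreover have "U (expvec v) = weyl_phase u v *\<^sub>C expvec (u + v)" for v
  proof -
    have "1 *\<^sub>C f = f" for f :: "'n fock" by (rule fock_eqI) simp
    then show ?thesis using U(2)[of "(1, v)"] by (simp add: e_def e'_def)
  qed
  ultimately show ?thesis by blast
qed

text \<open>Resolves the definite description in \<open>weyl\<close>. Surjectivity holds because the
  isometry for \<open>- u\<close> is a right inverse, as checked on exponential vectors; uniqueness
  follows from their totality.\<close>

lemma weyl:
  fixes u :: "complex ^ 'n::finite"
  shows "unitary_op (weyl u)" "weyl u (expvec v) = weyl_phase u v *\<^sub>C expvec (u + v)"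
proof -
  obtain U where U: "\<And>f g. cinner (U f) (U g) = cinner f g"
      "\<And>v. U (expvec v) = weyl_phase u v *\<^sub>C expvec (u + v)"
    using ex_weyl[of u] by blast
  obtain V where V: "\<And>f g. cinner (V f) (V g) = cinner f g"
      "\<And>v. V (expvec v) = weyl_phase (- u) v *\<^sub>C expvec (- u + v)"
    using ex_weyl[of "- u"] by blast
  have bU: "bounded_clinear U" and bV: "bounded_clinear V"
    by (rule cinner_preserving_imp_bounded_clinear; fact U(1) V(1))+
  have "(U \<circ> V) f = id f" for f
  proof (rule bounded_clinear_eq_onI[where A = "U \<circ> V" and B = id])
    show "bounded_clinear (U \<circ> V)" by (rule bounded_clinear_comp[OF bU bV])
    show "bounded_clinear (id :: 'n fock \<Rightarrow> _)"
      by (rule cinner_preserving_imp_bounded_clinear) simp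
    fix v
    have "weyl_phase (- u) v * weyl_phase u (- u + v) = 1"
      unfolding weyl_phase_def mult_exp_exp by (simp add: cdot_diff cdot_minus cdot_self)
    then have "coord (weyl_phase (- u) v *\<^sub>C weyl_phase u (- u + v) *\<^sub>C expvec v) xs = coord (expvec v) xs" for xs
      by (simp add: mult.assoc[symmetric])
    then have "weyl_phase (- u) v *\<^sub>C weyl_phase u (- u + v) *\<^sub>C expvec v = expvec v" by (rule fock_eqI)
    then show "(U \<circ> V) (expvec v) = id (expvec v)"
      by (simp add: U(2) V(2) bounded_clinearD[OF bU])
  qed
  then have "surj U" by (metis comp_apply id_apply surjI)
  then have un: "unitary_op U" using bU U(1) by (simp add: unitary_op_def)
  let ?P = "\<lambda>U. unitary_op U \<and>
     (\<forall>v. U (expvec v) = exp (- complex_of_real ((norm u)\<^sup>2 / 2) - cdot u v) *\<^sub>C expvec (u + v))"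
  have "\<exists>!U. ?P U"
  proof (rule ex1I)
    show "?P U" using un U(2) by (simp add: weyl_phase_def)
    fix U' assume U': "?P U'"
    show "U' = U"
      by (rule ext, rule bounded_clinear_eq_onI)
        (use U' un in \<open>auto simp: unitary_op_def U(2) weyl_phase_def\<close>)
  qed
  then have "?P (weyl u)" unfolding weyl_def by (rule theI')
  then show "unitary_op (weyl u)" "weyl u (expvec v) = weyl_phase u v *\<^sub>C expvec (u + v)"
    by (auto simp: weyl_phase_def)
qed

lemma cinner_weyl: "cinner (weyl u f) (weyl u g) = cinner f g"
  using weyl(1)[of u] by (simp add: unitary_op_def)

lemma bounded_clinear_weyl: "bounded_clinear (weyl u)"
  using weyl(1)[of u] by (simp add: unitary_op_def)

lemma norm_weyl: "norm (weyl u f) = norm f"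
  by (simp add: norm_eq_sqrt_inner inner_fock_def cinner_weyl)

section \<open>Orthonormal bases: unitary transport, expansion, Parseval\<close>

lemma unitary_image_orthonormal_basis:
  assumes U: "unitary_op U" and B: "orthonormal_basis B"
  shows "orthonormal_basis (U ` B)" "inj_on U B"
proof -
  have ci: "cinner (U f) (U g) = cinner f g" for f g using U by (simp add: unitary_op_def)
  have b: "cinner b c = (if b = c then 1 else 0)" if "b \<in> B" "c \<in> B" for b c
    using B that by (simp add: orthonormal_basis_def)
  show inj: "inj_on U B"
  proof (rule inj_onI)
    fix x y assume "x \<in> B" "y \<in> B" "U x = U y"
    then show "x = y" using b[of x y] b[of x x] ci[of x y] ci[of x x] by (auto split: if_splits)
  qed
  show "orthonormal_basis (U ` B)"
    unfolding orthonormal_basis_def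
  proof (intro conjI ballI allI impI)
    fix x y assume "x \<in> U ` B" "y \<in> U ` B"
    then show "cinner x y = (if x = y then 1 else 0)" using inj by (auto simp: ci b inj_on_eq_iff)
  next
    fix f assume f: "\<forall>b\<in>U ` B. cinner b f = 0"
    obtain g where g: "f = U g" using U unfolding unitary_op_def by (metis surjD)
    have "g = 0" using f B by (simp add: g ci orthonormal_basis_def)
    then show "f = 0" using U by (simp add: g unitary_op_def bounded_clinearD(4))
  qed
qed

text \<open>The finite partial expansions are contractions by Bessel's inequality and eventually fix
  every vector in the span of \<open>B\<close>; completeness of \<open>B\<close> makes that span
  dense, so they converge everywhere.\<close>

lemma orthonormal_expansion:
  fixes y :: "'n::finite fock"
  assumes B: "orthonormal_basis B"
  shows "((\<lambda>b. cinner b y *\<^sub>C b) has_sum y) B"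
proof -
  have on: "cinner b c = (if b = c then 1 else 0)" if "b \<in> B" "c \<in> B" for b c
    using B that by (simp add: orthonormal_basis_def)
  define P where "P F x = (\<Sum>b\<in>F. cinner b x *\<^sub>C b)" for F and x :: "'n fock"
  have sdl: "(c + d) *\<^sub>C f = c *\<^sub>C f + d *\<^sub>C f" and sa: "c *\<^sub>C d *\<^sub>C f = (c * d) *\<^sub>C f"
    for c d and f :: "'n fock"
    by (auto intro!: fock_eqI simp: algebra_simps)
  have P_add: "P F (x + z) = P F x + P F z" for F x z
    by (simp add: P_def cinner_simps sdl sum.distrib)
  have P_scale: "P F (c *\<^sub>C x) = c *\<^sub>C P F x" for F c x
  proof (rule fock_eqI)
    show "coord (P F (c *\<^sub>C x)) xs = coord (c *\<^sub>C P F x) xs" for xs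
      by (simp add: P_def coord_sum cinner_simps sum_distrib_left mult.assoc)
  qed
  have P_diff: "P F (x - z) = P F x - P F z" for F x z
    using P_add[of F "x - z" z] by simp
  have bessel: "norm (P F x) \<le> norm x" if "finite F" "F \<subseteq> B" for F x
  proof -
    have 1: "cinner b (P F x) = cinner b x" if "b \<in> F" for b
    proof -
      have "cinner b (P F x) = (\<Sum>c\<in>F. cinner c x * (if b = c then 1 else 0))"
        unfolding P_def cinner_sum_right cinner_simps
        using that \<open>F \<subseteq> B\<close> by (intro sum.cong) (auto simp: on subset_iff)
      then show ?thesis using that \<open>finite F\<close> by (simp add: if_distrib cong: if_cong)
    qed
    \<comment> \<open>\<open>P F\<close> acts as an orthogonal projection, so Pythagoras for
      \<open>x - P F x\<close> yields Bessel's inequality.\<close>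
    have 2: "cinner (P F x) (P F x) = cinner (P F x) x"
      unfolding P_def[of F x] cinner_sum_left
      by (intro sum.cong) (simp_all add: cinner_simps P_def[symmetric] 1)
    have "0 \<le> (norm (x - P F x))\<^sup>2" by simp
    also have "(norm (x - P F x))\<^sup>2 = (norm x)\<^sup>2 - (norm (P F x))\<^sup>2"
    proof -
      have "complex_of_real ((norm (x - P F x))\<^sup>2) = cinner x x - cinner x (P F x)"
        unfolding cinner_self_norm[symmetric] by (simp add: cinner_simps 2)
      also have "cinner x (P F x) = cinner (P F x) (P F x)"
        by (subst cinner_commute) (simp add: 2[symmetric] cinner_self_norm)
      finally show ?thesis unfolding cinner_self_norm by (metis of_real_diff of_real_eq_iff)
    qed
    finally show ?thesis by (simp add: power2_le_iff_abs_le)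
  qed
  \<comment> \<open>All sufficiently large finite expansions of \<open>z\<close> are already exact;
    the vectors of the span have this property and approximate a general \<open>y\<close>.\<close>
  define Q where "Q z \<longleftrightarrow> (\<exists>F. finite F \<and> F \<subseteq> B \<and> (\<forall>F'. finite F' \<and> F \<subseteq> F' \<and> F' \<subseteq> B \<longrightarrow> P F' z = z))" for z
  have Q_add: "Q (x + z)" if Qx: "Q x" and Qz: "Q z" for x z
  proof -
    obtain F where "finite F" "F \<subseteq> B" "\<And>F'. finite F' \<Longrightarrow> F \<subseteq> F' \<Longrightarrow> F' \<subseteq> B \<Longrightarrow> P F' x = x"
      using Qx unfolding Q_def by auto
    moreover obtain G where
      "finite G" "G \<subseteq> B" "\<And>F'. finite F' \<Longrightarrow> G \<subseteq> F' \<Longrightarrow> F' \<subseteq> B \<Longrightarrow> P F' z = z"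
      using Qz unfolding Q_def by auto
    ultimately show ?thesis unfolding Q_def by (intro exI[of _ "F \<union> G"]) (auto simp: P_add)
  qed
  have Q_base: "Q (r *\<^sub>R c *\<^sub>C b)" if "b \<in> B" for r c b
    unfolding Q_def
  proof (intro exI[of _ "{b}"] conjI allI impI)
    fix F' assume F': "finite F' \<and> {b} \<subseteq> F' \<and> F' \<subseteq> B"
    have "P F' b = (\<Sum>c\<in>F'. if c = b then b else 0)"
      unfolding P_def using F' that
      by (intro sum.cong) (auto simp: on subset_iff intro!: fock_eqI)
    then have "P F' b = b" using F' by simp
    then show "P F' (r *\<^sub>R c *\<^sub>C b) = r *\<^sub>R c *\<^sub>C b"
      by (simp add: scaleR_eq_scaleC P_scale)
  qed (use that in auto)
  have Q: "Q z" if "z \<in> span {c *\<^sub>C s |c s. s \<in> B}" for z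
    using that
  proof (induction rule: span_induct_alt)
    case base
    have "0 *\<^sub>C b = 0" for b :: "'n fock" by (rule fock_eqI) simp
    then show ?case by (auto simp: Q_def P_def intro!: exI[of _ "{}"])
  next
    case (step c x y)
    then show ?case by (auto intro!: Q_add Q_base)
  qed
  have dense: "closure (span {c *\<^sub>C s |c s. s \<in> B}) = UNIV"
    by (rule closure_cspan_eq_UNIV) (use B in \<open>auto simp: orthonormal_basis_def\<close>)
  show ?thesis
    unfolding has_sum_def
  proof (rule tendstoI)
    fix e :: real assume e: "0 < e"
    have "y \<in> closure (span {c *\<^sub>C s |c s. s \<in> B})" by (simp add: dense)
    then obtain z where z: "z \<in> span {c *\<^sub>C s |c s. s \<in> B}" "dist z y < e / 2"
      using e unfolding closure_approachable by (meson half_gt_zero)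
    obtain F where F: "finite F" "F \<subseteq> B" "\<And>F'. finite F' \<Longrightarrow> F \<subseteq> F' \<Longrightarrow> F' \<subseteq> B \<Longrightarrow> P F' z = z"
      using Q[OF z(1)] unfolding Q_def by auto
    have "dist (P F' y) y < e" if "finite F'" "F \<subseteq> F'" "F' \<subseteq> B" for F'
    proof -
      have "norm (P F' y - y) = norm (P F' (y - z) + (z - y))" using F(3)[OF that] by (simp add: P_diff)
      also have "\<dots> \<le> norm (P F' (y - z)) + norm (z - y)" by (rule norm_triangle_ineq)
      also have "\<dots> \<le> norm (y - z) + norm (z - y)" using bessel[OF that(1,3)] by simp
      also have "\<dots> < e" using z(2) by (simp add: dist_norm norm_minus_commute)
      finally show ?thesis by (simp add: dist_norm)
    qed
    then show "\<forall>\<^sub>F F in finite_subsets_at_top B. dist (\<Sum>b\<in>F. cinner b y *\<^sub>C b) y < e"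
      unfolding eventually_finite_subsets_at_top P_def using F by blast
  qed
qed

lemma parseval:
  assumes "orthonormal_basis B"
  shows "((\<lambda>b. cinner b y * cinner x b) has_sum cinner x y) B"
  using has_sum_bounded_linear[OF bounded_linear_cinner_right orthonormal_expansion[OF assms], of x y]
  by (simp add: cinner_scaleC_right)

section \<open>Occupation numbers and traces\<close>

text \<open>Polarisation: reality of the quadratic form at \<open>f + g\<close> and at
  \<open>f + \<i> *\<^sub>C g\<close> gives the imaginary and the real part.\<close>

lemma positive_op_selfadjoint:
  assumes "positive_op A"
  shows "cinner f (A g) = cinner (A f) g"
proof -
  have A: "bounded_clinear A" and q: "Im (cinner f (A f)) = 0" for f
    using assms by (auto simp: positive_op_def complex_nonneg_Reals_iff)
  have "Im (cinner f (A g)) + Im (cinner g (A f)) = 0"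
    using q[of "f + g"] q[of f] q[of g] by (simp add: cinner_simps bounded_clinearD[OF A])
  moreover have "Re (cinner f (A g)) = Re (cinner g (A f))"
    using q[of "f + \<i> *\<^sub>C g"] q[of f] q[of g] by (simp add: cinner_simps bounded_clinearD[OF A])
  ultimately show ?thesis
    by (subst (2) cinner_commute) (simp add: complex_eq_iff)
qed

text \<open>Cauchy-Schwarz for the semidefinite form of \<open>A\<close>, in the arithmetic-mean
  version that follows from positivity at \<open>f - w *\<^sub>C g\<close>. An additive bound can be
  summed over a basis and yields traces.\<close>

lemma positive_op_norm_cinner_le:
  assumes "positive_op A"
  shows "norm (cinner f (A g)) \<le> (Re (cinner f (A f)) + Re (cinner g (A g))) / 2"
proof -
  have A: "bounded_clinear A" and q: "0 \<le> Re (cinner f (A f))" for f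
    using assms by (auto simp: positive_op_def complex_nonneg_Reals_iff)
  define z where "z = cinner f (A g)"
  \<comment> \<open>A phase that turns \<open>z\<close> into its modulus; at \<open>z = 0\<close>
    the value 1 keeps \<open>norm w = 1\<close>.\<close>
  define w where "w = (if z = 0 then 1 else cnj (sgn z))"
  have "norm w = 1" by (simp add: w_def norm_sgn)
  then have w1: "cnj w * w = 1" using complex_norm_square[of w] by (simp add: mult.commute)
  have w2: "w * z = complex_of_real (norm z)"
  proof (cases "z = 0")
    case False
    then have "w * z = complex_of_real ((norm z)\<^sup>2) / complex_of_real (norm z)"
      unfolding complex_norm_square by (simp add: w_def sgn_eq mult.commute)
    then show ?thesis using False by (simp add: power2_eq_square)
  qed simp
  have z': "cinner g (A f) = cnj z"
    unfolding z_def by (subst cinner_commute) (simp add: positive_op_selfadjoint[OF assms])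
  have "cinner (f - w *\<^sub>C g) (A (f - w *\<^sub>C g))
      = cinner f (A f) - w * z - cnj (w * z) + (cnj w * w) * cinner g (A g)"
    by (simp add: cinner_simps bounded_clinearD[OF A] z' z_def[symmetric] algebra_simps)
  then have "Re (cinner (f - w *\<^sub>C g) (A (f - w *\<^sub>C g)))
      = Re (cinner f (A f)) + Re (cinner g (A g)) - 2 * norm z"
    unfolding w1 w2 by simp
  then show ?thesis using q[of "f - w *\<^sub>C g"] unfolding z_def by simp
qed

section \<open>The occupation number basis\<close>

lemma finite_mset_words: "finite {xs :: 'n::finite list. mset xs = M}"
  by (rule finite_subset[OF _ finite_words[of "size M"]]) auto

lemma finite_multisets: "finite {M :: 'n::finite multiset. size M = k}"
proof (rule finite_subset)
  show "{M :: 'n multiset. size M = k} \<subseteq> mset ` {xs. length xs = k}"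
  proof
    fix M :: "'n multiset" assume "M \<in> {M. size M = k}"
    moreover obtain xs where "mset xs = M" using ex_mset by blast
    ultimately show "M \<in> mset ` {xs. length xs = k}" by auto
  qed
qed (intro finite_imageI finite_words)

text \<open>The occupation number state, with \<open>M\<close> counting the particles in each mode:
  the normalised indicator of all words listing \<open>M\<close>.\<close>

lift_definition occ :: "'n::finite multiset \<Rightarrow> 'n fock"
  is "\<lambda>M xs. if mset xs = M then 1 / complex_of_real (sqrt (card {xs. mset xs = M})) else 0"
proof (rule sym_l2_I)
  fix M :: "'n multiset"
  have "(\<lambda>xs. (norm (if mset xs = M then 1 / complex_of_real (sqrt (card {xs. mset xs = M})) else 0))\<^sup>2)
      summable_on {xs. mset xs = M}"
    by (rule summable_on_finite[OF finite_mset_words])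
  then show "(\<lambda>xs. (norm (if mset xs = M then 1 / complex_of_real (sqrt (card {xs. mset xs = M})) else 0))\<^sup>2)
      summable_on UNIV"
    by (rule summable_on_cong_neutral[THEN iffD1, rotated -1]) auto
qed simp

lemma card_mset_words_pos: "0 < card {ys :: 'n::finite list. mset ys = mset xs}"
  using finite_mset_words by (subst card_gt_0_iff) auto

lemma cinner_occ:
  "cinner (occ (mset xs)) f = complex_of_real (sqrt (card {ys. mset ys = mset xs})) * coord f xs"
proof -
  let ?M = "{ys. mset ys = mset xs}"
  have "((\<lambda>ys. cnj (coord (occ (mset xs)) ys) * coord f ys) has_sum
      (\<Sum>ys\<in>?M. cnj (coord (occ (mset xs)) ys) * coord f ys)) UNIV"
    by (rule has_sum_finite_neutralI[OF finite_mset_words[of "mset xs"]]) (auto simp: occ.rep_eq)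
  then have "cinner (occ (mset xs)) f = (\<Sum>ys\<in>?M. cnj (coord (occ (mset xs)) ys) * coord f ys)"
    unfolding cinner_def by (rule infsumI)
  also have "\<dots> = (\<Sum>ys\<in>?M. coord f xs / complex_of_real (sqrt (card ?M)))"
    by (intro sum.cong) (auto simp: occ.rep_eq intro!: arg_cong2[where f = "(/)"] sym_l2_D(1)[OF coord])
  also have "\<dots> = complex_of_real (card ?M / sqrt (card ?M)) * coord f xs" by simp
  also have "real (card ?M) / sqrt (card ?M) = sqrt (card ?M)"
    by (rule real_div_sqrt) simp
  finally show ?thesis .
qed

lemma coord_eq_cinner_occ: "coord f xs = cinner (occ (mset xs)) f * coord (occ (mset xs)) xs"
  using card_mset_words_pos[of xs] by (simp add: cinner_occ occ.rep_eq)

lemma cinner_occ_occ: "cinner (occ M) (occ N) = (if M = N then 1 else 0)"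
proof -
  obtain xs where xs: "mset xs = M" using ex_mset by blast
  show ?thesis
    unfolding xs[symmetric] cinner_occ using card_mset_words_pos[of xs] by (auto simp: occ.rep_eq)
qed

lemma inj_occ: "inj occ"
  by (rule injI) (metis cinner_occ_occ zero_neq_one)

lemma orthonormal_basis_occ: "orthonormal_basis (range occ)"
  unfolding orthonormal_basis_def
proof (intro conjI ballI allI impI)
  show "cinner b c = (if b = c then 1 else 0)" if "b \<in> range occ" "c \<in> range occ" for b c :: "'a fock"
    using that by (auto simp: cinner_occ_occ inj_eq[OF inj_occ])
  show "f = 0" if "\<forall>b\<in>range occ. cinner b f = 0" for f :: "'a fock"
    using that by (intro fock_eqI) (subst coord_eq_cinner_occ, simp)
qed

lemma particle_proj_eq: "particle_proj k f = (\<Sum>M | size M = k. cinner (occ M) f *\<^sub>C occ M)"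
proof (rule fock_eqI)
  fix xs
  have "coord (\<Sum>M | size M = k. cinner (occ M) f *\<^sub>C occ M) xs
      = (\<Sum>M | size M = k. if M = mset xs then coord f xs else 0)"
    unfolding coord_sum
    by (intro sum.cong) (auto simp: occ.rep_eq coord_eq_cinner_occ[of f xs])
  also have "\<dots> = coord (particle_proj k f) xs"
    using finite_multisets by (subst sum.delta) (auto simp: particle_proj.rep_eq)
  finally show "coord (particle_proj k f) xs = coord (\<Sum>M | size M = k. cinner (occ M) f *\<^sub>C occ M) xs" ..
qed

lemma bounded_clinearI:
  assumes "\<And>f g. A (f + g) = A f + A g" "\<And>c f. A (c *\<^sub>C f) = c *\<^sub>C A f" "\<And>f. norm (A f) \<le> norm f"
  shows "bounded_clinear A"
  unfolding bounded_clinear_def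
  by (intro conjI bounded_linear_intro[of _ 1]) (use assms in \<open>auto simp: scaleR_eq_scaleC\<close>)

lemma bounded_clinear_particle_proj: "bounded_clinear (particle_proj k)"
proof (rule bounded_clinearI)
  fix f :: "'a fock"
  have "(norm (particle_proj k f))\<^sup>2 \<le> (norm f)\<^sup>2"
    unfolding norm_fock_sq
    by (rule infsum_mono[OF coord_sq_summable coord_sq_summable]) (simp add: particle_proj.rep_eq)
  then show "norm (particle_proj k f) \<le> norm f" by (rule power2_le_imp_le) simp
qed (auto intro!: fock_eqI simp: particle_proj.rep_eq)

lemma has_sum_finite_sum:
  fixes f :: "'i \<Rightarrow> 'a \<Rightarrow> 'b::topological_comm_monoid_add"
  assumes "\<And>i. i \<in> I \<Longrightarrow> (f i has_sum s i) A"
  shows "((\<lambda>x. \<Sum>i\<in>I. f i x) has_sum (\<Sum>i\<in>I. s i)) A"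
  using assms by (induction I rule: infinite_finite_induct) (auto intro: has_sum_add)

lemma has_trace_unique:
  assumes "has_trace A s" "has_trace A t"
  shows "s = t"
  using assms orthonormal_basis_occ unfolding has_trace_def by (blast intro: has_sum_unique)

text \<open>\<open>particle_proj k\<close> has finite rank, so the diagonal in any basis
  \<open>B\<close> is a finite combination of Parseval sums.\<close>

lemma has_trace_comp_particle_proj:
  assumes A: "bounded_clinear A"
  shows "has_trace (A \<circ> particle_proj k) (\<Sum>M | size M = k. cinner (occ M) (A (occ M)))"
  unfolding has_trace_def
proof (intro conjI allI impI)
  show "bounded_clinear (A \<circ> particle_proj k)"
    by (rule bounded_clinear_comp[OF A bounded_clinear_particle_proj])
  fix B :: "'a fock set" assume B: "orthonormal_basis B"
  have "((\<lambda>b. \<Sum>M | size M = k. cinner b (A (occ M)) * cinner (occ M) b) has_sum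
      (\<Sum>M | size M = k. cinner (occ M) (A (occ M)))) B"
    by (rule has_sum_finite_sum) (rule parseval[OF B])
  moreover have "cinner b ((A \<circ> particle_proj k) b)
      = (\<Sum>M | size M = k. cinner b (A (occ M)) * cinner (occ M) b)" for b
    by (simp add: particle_proj_eq bounded_clinearD[OF A] cinner_sum_right cinner_simps mult.commute)
  ultimately show "((\<lambda>b. cinner b ((A \<circ> particle_proj k) b)) has_sum
      (\<Sum>M | size M = k. cinner (occ M) (A (occ M)))) B" by simp
qed

text \<open>Existence from the finite-rank trace and uniqueness from the occupation basis resolve
  the definite description in \<open>op_trace\<close>.\<close>

lemma number_prob_eq:
  assumes "bounded_clinear \<rho>"
  shows "number_prob \<rho> k = (\<Sum>M | size M = k. Re (cinner (occ M) (\<rho> (occ M))))"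
proof -
  have "op_trace (\<rho> \<circ> particle_proj k) = (\<Sum>M | size M = k. cinner (occ M) (\<rho> (occ M)))"
    unfolding op_trace_def
    by (rule the_equality[where P = "has_trace _"]) (auto intro: has_trace_comp_particle_proj[OF assms] has_trace_unique)
  then show ?thesis by (simp add: number_prob_def)
qed

section \<open>Gaussian integrals\<close>

text \<open>Completing the square in the real part of the exponent reduces the integral to the
  characteristic function of the standard normal law, so no contour has to be shifted.\<close>

lemma gaussian_integral_complex:
  fixes a :: real and \<zeta> :: complex
  assumes a: "0 < a"
  shows "has_bochner_integral lborel (\<lambda>y. exp (complex_of_real (- a * y\<^sup>2) + \<zeta> * complex_of_real y))
    (complex_of_real (sqrt (pi / a)) * exp (\<zeta>\<^sup>2 / (4 * complex_of_real a)))"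
proof -
  \<comment> \<open>\<open>c\<close> is the maximum point of the real part of the exponent and
    \<open>r\<close> rescales to unit variance; the imaginary part of \<open>\<zeta>\<close> then
    becomes the frequency \<open>t = q * r\<close>.\<close>
  define p q c r where "p = Re \<zeta>" "q = Im \<zeta>" "c = p / (2 * a)" "r = 1 / sqrt (2 * a)"
  have z: "\<zeta> = Complex p q" by (simp add: p_q_c_r_def)
  have r: "0 < r" "r * r = 1 / (2 * a)" using a by (simp_all add: p_q_c_r_def)
  define t where "t = q * r"
  interpret real_distribution std_normal_distribution by (rule real_dist_normal_dist)
  have "integrable std_normal_distribution (\<lambda>x. iexp (t * x))" by (rule integrable_iexp) simp_all
  then have "integrable lborel (\<lambda>x. std_normal_density x *\<^sub>R iexp (t * x))"
    by (subst (asm) integrable_density) simp_all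
  moreover have "(LINT x|lborel. std_normal_density x *\<^sub>R iexp (t * x)) = complex_of_real (exp (- (t\<^sup>2) / 2))"
    using fun_cong[OF char_std_normal_distribution, of t] unfolding char_def
    by (subst (asm) integral_density) simp_all
  ultimately have "has_bochner_integral lborel (\<lambda>x. std_normal_density x *\<^sub>R iexp (t * x))
      (complex_of_real (exp (- (t\<^sup>2) / 2)))"
    by (simp add: has_bochner_integral_iff)
  then have "has_bochner_integral lborel
      (\<lambda>x. (complex_of_real (sqrt (2 * pi)) * exp (\<zeta> * c - complex_of_real (a * c\<^sup>2))) *
          (std_normal_density x *\<^sub>R iexp (t * x)))
      ((complex_of_real (sqrt (2 * pi)) * exp (\<zeta> * c - complex_of_real (a * c\<^sup>2))) * complex_of_real (exp (- (t\<^sup>2) / 2)))"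
    by (rule has_bochner_integral_mult_right)
  moreover have "(complex_of_real (sqrt (2 * pi)) * exp (\<zeta> * c - complex_of_real (a * c\<^sup>2))) *
          (std_normal_density x *\<^sub>R iexp (t * x))
      = exp (complex_of_real (- a * (c + r * x)\<^sup>2) + \<zeta> * complex_of_real (c + r * x))" for x
  proof -
    have e: "\<zeta> * c - complex_of_real (a * c\<^sup>2) + complex_of_real (- x\<^sup>2 / 2) + \<i> * complex_of_real (t * x)
        = complex_of_real (- a * (c + r * x)\<^sup>2) + \<zeta> * complex_of_real (c + r * x)"
    proof (rule complex_eqI)
      have 1: "a * (r * r) = 1 / 2" using a r by simp
      have "a * (c + r * x)\<^sup>2 = a * c\<^sup>2 + 2 * a * c * r * x + a * (r * r) * x\<^sup>2"
        by (simp add: power2_eq_square algebra_simps)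
      moreover have "2 * a * c = p" using a by (simp add: p_q_c_r_def)
      ultimately have "a * (c + r * x)\<^sup>2 = a * c\<^sup>2 + p * r * x + x\<^sup>2 / 2" unfolding 1 by simp
      then show "Re (\<zeta> * c - complex_of_real (a * c\<^sup>2) + complex_of_real (- x\<^sup>2 / 2) + \<i> * complex_of_real (t * x))
        = Re (complex_of_real (- a * (c + r * x)\<^sup>2) + \<zeta> * complex_of_real (c + r * x))"
        by (simp add: z algebra_simps del: of_real_power)
    qed (simp add: z t_def algebra_simps)
    have "complex_of_real (sqrt (2 * pi)) * complex_of_real (std_normal_density x) = exp (complex_of_real (- x\<^sup>2 / 2))"
      unfolding std_normal_density_def of_real_mult[symmetric] exp_of_real by simp
    then show ?thesis
      unfolding e[symmetric] exp_add scaleR_conv_of_real by (simp add: mult_ac)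
  qed
  ultimately have "has_bochner_integral lborel
      (\<lambda>x. exp (complex_of_real (- a * (c + r * x)\<^sup>2) + \<zeta> * complex_of_real (c + r * x)))
      ((complex_of_real (sqrt (2 * pi)) * exp (\<zeta> * c - complex_of_real (a * c\<^sup>2))) * complex_of_real (exp (- (t\<^sup>2) / 2)))"
    by simp
  moreover have "(complex_of_real (sqrt (2 * pi)) * exp (\<zeta> * c - complex_of_real (a * c\<^sup>2))) * complex_of_real (exp (- (t\<^sup>2) / 2))
      = (complex_of_real (sqrt (pi / a)) * exp (\<zeta>\<^sup>2 / (4 * complex_of_real a))) /\<^sub>R \<bar>r\<bar>"
  proof -
    have "\<zeta> * c - complex_of_real (a * c\<^sup>2) + complex_of_real (- (t\<^sup>2) / 2) = \<zeta>\<^sup>2 / (4 * complex_of_real a)"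
    proof -
      have t2: "t\<^sup>2 = q\<^sup>2 / (2 * a)"
        using r(2) by (simp add: t_def power_mult_distrib power2_eq_square mult_ac)
      have t2c: "(complex_of_real t)\<^sup>2 = (complex_of_real q)\<^sup>2 / (2 * complex_of_real a)"
        by (simp add: t2 flip: of_real_power)
      have \<zeta>: "\<zeta> = complex_of_real p + \<i> * complex_of_real q" by (simp add: z Complex_eq)
      have sq: "2 * \<zeta> * complex_of_real p - (complex_of_real p)\<^sup>2 - (complex_of_real q)\<^sup>2 = \<zeta>\<^sup>2"
        unfolding \<zeta> by (simp add: power2_eq_square algebra_simps)
      have "\<zeta> * c - complex_of_real (a * c\<^sup>2) + complex_of_real (- (t\<^sup>2) / 2)
          = (2 * \<zeta> * complex_of_real p - (complex_of_real p)\<^sup>2 - (complex_of_real q)\<^sup>2) / (4 * complex_of_real a)"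
        using a by (simp add: t2c p_q_c_r_def(3)) (simp add: field_simps power2_eq_square)
      then show ?thesis unfolding sq .
    qed
    then have E: "exp (\<zeta> * c - complex_of_real (a * c\<^sup>2)) * complex_of_real (exp (- (t\<^sup>2) / 2)) = exp (\<zeta>\<^sup>2 / (4 * complex_of_real a))"
      by (simp only: exp_of_real[symmetric] mult_exp_exp)
    have R: "sqrt (2 * pi) = sqrt (pi / a) / \<bar>r\<bar>"
      using a by (simp add: p_q_c_r_def real_sqrt_divide real_sqrt_mult)
    have "complex_of_real (u / v) * X = (complex_of_real u * X) /\<^sub>R v" for u v X
      by (simp add: scaleR_conv_of_real divide_inverse)
    then show ?thesis unfolding mult.assoc E unfolding R .
  qed
  ultimately have "has_bochner_integral lborel
      (\<lambda>x. exp (complex_of_real (- a * (c + r * x)\<^sup>2) + \<zeta> * complex_of_real (c + r * x)))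
      ((complex_of_real (sqrt (pi / a)) * exp (\<zeta>\<^sup>2 / (4 * complex_of_real a))) /\<^sub>R \<bar>r\<bar>)"
    by (simp only:)
  moreover have "r \<noteq> 0" using r(1) by simp
  ultimately show ?thesis
    by (subst lborel_has_bochner_integral_real_affine_iff[where c = r and t = c])
qed

lemma gaussian_integral_product:
  fixes a :: "'i \<Rightarrow> real" and \<zeta> :: "'i \<Rightarrow> complex"
  assumes I: "finite I" and a: "\<And>i. i \<in> I \<Longrightarrow> 0 < a i" and s: "0 < s"
  shows "has_bochner_integral (Pi\<^sub>M I (\<lambda>_. lborel))
    (\<lambda>y. \<Prod>i\<in>I. complex_of_real (1 / sqrt (pi * s)) *
        exp (complex_of_real (- a i * (y i)\<^sup>2) + \<zeta> i * complex_of_real (y i)))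
    (\<Prod>i\<in>I. complex_of_real (1 / sqrt (s * a i)) * exp ((\<zeta> i)\<^sup>2 / (4 * complex_of_real (a i))))"
proof -
  interpret product_sigma_finite "\<lambda>_ :: 'i. lborel :: real measure" ..
  have h: "has_bochner_integral lborel
     (\<lambda>y. complex_of_real (1 / sqrt (pi * s)) *
        exp (complex_of_real (- a i * y\<^sup>2) + \<zeta> i * complex_of_real y))
     (complex_of_real (1 / sqrt (s * a i)) * exp ((\<zeta> i)\<^sup>2 / (4 * complex_of_real (a i))))"
    if i: "i \<in> I" for i
  proof -
    have "1 / sqrt (pi * s) * sqrt (pi / a i) = 1 / sqrt (s * a i)"
      using a[OF i] s by (simp add: real_sqrt_mult real_sqrt_divide)
    then have "complex_of_real (1 / sqrt (s * a i)) = complex_of_real (1 / sqrt (pi * s)) * complex_of_real (sqrt (pi / a i))"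
      by (simp only: of_real_mult[symmetric])
    then show ?thesis
      unfolding mult.assoc
      using has_bochner_integral_mult_right[OF gaussian_integral_complex[OF a[OF i], of "\<zeta> i"], of "complex_of_real (1 / sqrt (pi * s))"]
      by (simp add: mult.assoc)
  qed
  show ?thesis
    unfolding has_bochner_integral_iff
  proof
    show "integrable (Pi\<^sub>M I (\<lambda>_. lborel)) (\<lambda>y. \<Prod>i\<in>I. complex_of_real (1 / sqrt (pi * s)) *
        exp (complex_of_real (- a i * (y i)\<^sup>2) + \<zeta> i * complex_of_real (y i)))"
      by (rule product_integrable_prod[OF I, where f = "\<lambda>i y. complex_of_real (1 / sqrt (pi * s)) *
          exp (complex_of_real (- a i * y\<^sup>2) + \<zeta> i * complex_of_real y)"]) (rule h[THEN integrable.intros])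
    have "(LINT y|Pi\<^sub>M I (\<lambda>_. lborel). (\<Prod>i\<in>I. complex_of_real (1 / sqrt (pi * s)) *
        exp (complex_of_real (- a i * (y i)\<^sup>2) + \<zeta> i * complex_of_real (y i))))
      = (\<Prod>i\<in>I. LINT y|lborel. complex_of_real (1 / sqrt (pi * s)) *
          exp (complex_of_real (- a i * y\<^sup>2) + \<zeta> i * complex_of_real y))"
      by (rule product_integral_prod[OF I, where f = "\<lambda>i y. complex_of_real (1 / sqrt (pi * s)) *
          exp (complex_of_real (- a i * y\<^sup>2) + \<zeta> i * complex_of_real y)"]) (rule h[THEN integrable.intros])
    also have "\<dots> = (\<Prod>i\<in>I. complex_of_real (1 / sqrt (s * a i)) * exp ((\<zeta> i)\<^sup>2 / (4 * complex_of_real (a i))))"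
      by (rule prod.cong[OF refl]) (rule has_bochner_integral_integral_eq[OF h])
    finally show "(LINT y|Pi\<^sub>M I (\<lambda>_. lborel). (\<Prod>i\<in>I. complex_of_real (1 / sqrt (pi * s)) *
        exp (complex_of_real (- a i * (y i)\<^sup>2) + \<zeta> i * complex_of_real (y i))))
      = (\<Prod>i\<in>I. complex_of_real (1 / sqrt (s * a i)) * exp ((\<zeta> i)\<^sup>2 / (4 * complex_of_real (a i))))" .
  qed
qed

lemma has_bochner_integral_dominated_limit:
  fixes F :: "nat \<Rightarrow> 'a \<Rightarrow> 'b::{banach, second_countable_topology}"
  assumes F: "\<And>n. has_bochner_integral M (F n) (I n)" and I: "I \<longlonglongrightarrow> L"
    and G: "\<And>y. (\<lambda>n. F n y) \<longlonglongrightarrow> G y" and K: "integrable M K" "\<And>n y. norm (F n y) \<le> K y"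
  shows "has_bochner_integral M G L"
proof -
  have Fm: "F n \<in> borel_measurable M" for n
    using F[of n] by (intro borel_measurable_integrable integrable.intros)
  have Gm: "G \<in> borel_measurable M"
    by (rule borel_measurable_LIMSEQ_metric[OF Fm]) (rule G)
  have "integrable M G"
    by (rule integrable_dominated_convergence[where w = K and s = F]) (use Gm Fm K G in auto)
  moreover have "(\<lambda>n. integral\<^sup>L M (F n)) \<longlonglongrightarrow> integral\<^sup>L M G"
    by (rule integral_dominated_convergence[where w = K]) (use Gm Fm K G in auto)
  then have "integral\<^sup>L M G = L"
    using I F LIMSEQ_unique by (metis (no_types, lifting) ext has_bochner_integral_integral_eq)
  ultimately show ?thesis by (simp add: has_bochner_integral_iff)
qed

text \<open>A nonzero remainder would be orthogonal to all \<open>b i\<close> and give more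
  independent vectors than the dimension allows.\<close>

lemma orthonormal_family_expand:
  fixes b :: "'i \<Rightarrow> 'a::euclidean_space"
  assumes J: "finite J" "card J = DIM('a)"
    and on: "\<And>i j. i \<in> J \<Longrightarrow> j \<in> J \<Longrightarrow> inner (b i) (b j) = (if i = j then 1 else 0)"
  shows "x = (\<Sum>j\<in>J. inner x (b j) *\<^sub>R b j)"
proof -
  define r where "r = x - (\<Sum>j\<in>J. inner x (b j) *\<^sub>R b j)"
  have orth: "inner r (b i) = 0" if "i \<in> J" for i
  proof -
    have "inner (\<Sum>j\<in>J. inner x (b j) *\<^sub>R b j) (b i) = (\<Sum>j\<in>J. if j = i then inner x (b i) else 0)"
      unfolding inner_sum_left by (intro sum.cong) (auto simp: on that)
    then show ?thesis using J(1) that by (simp add: r_def inner_diff_left)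
  qed
  have inj: "inj_on b J"
  proof (rule inj_onI)
    fix i j assume "i \<in> J" "j \<in> J" "b i = b j"
    then show "i = j" using on[of i j] on[of i i] by (auto split: if_splits)
  qed
  have "r = 0"
  proof (rule ccontr)
    assume r: "r \<noteq> 0"
    have rb: "r \<noteq> b i" if "i \<in> J" for i
      using orth[OF that] on[OF that that] r by auto
    have "pairwise orthogonal (insert r (b ` J))"
      unfolding pairwise_def orthogonal_def
      using orth on by (auto simp: inner_commute)
    moreover have "0 \<notin> insert r (b ` J)" using r on by fastforce
    ultimately have "independent (insert r (b ` J))" by (rule pairwise_orthogonal_independent)
    then have "card (insert r (b ` J)) \<le> DIM('a)" by (rule independent_bound[THEN conjunct2])
    moreover have "card (insert r (b ` J)) = Suc (card J)"
      using rb J(1) by (subst card_insert_disjoint) (auto simp: card_image[OF inj])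
    ultimately show False using J(2) by simp
  qed
  then show ?thesis by (simp add: r_def)
qed

section \<open>The Weyl expansion of the number operator\<close>

text \<open>The operator \<open>z ^ N\<close>. It is unbounded for \<open>norm z > 1\<close>, where
  the value 0 keeps the definition total.\<close>

lift_definition fock_dilation :: "complex \<Rightarrow> 'n::finite fock \<Rightarrow> 'n fock"
  is "\<lambda>z f xs. if norm z \<le> 1 then z ^ length xs * f xs else 0"
proof (rule sym_l2_I)
  fix z and f :: "'n list \<Rightarrow> complex" and xs ys :: "'n list"
  assume f: "f \<in> sym_l2" and eq: "mset xs = mset ys"
  show "(if norm z \<le> 1 then z ^ length xs * f xs else 0) = (if norm z \<le> 1 then z ^ length ys * f ys else 0)"
    by (simp only: mset_eq_length[OF eq] sym_l2_D(1)[OF f eq])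
next
  fix z and f :: "'n list \<Rightarrow> complex"
  assume f: "f \<in> sym_l2"
  show "(\<lambda>xs. (norm (if norm z \<le> 1 then z ^ length xs * f xs else 0))\<^sup>2) summable_on UNIV"
    by (rule summable_on_comparison_test[OF sym_l2_D(2)[OF f]])
      (auto simp: norm_mult norm_power power_le_one mult_left_le_one_le)
qed

lemma bounded_clinear_fock_dilation: "bounded_clinear (fock_dilation z)"
proof (rule bounded_clinearI)
  fix f :: "'a fock"
  have "(norm (fock_dilation z f))\<^sup>2 \<le> (norm f)\<^sup>2"
    unfolding norm_fock_sq
    by (rule infsum_mono[OF coord_sq_summable coord_sq_summable])
      (auto simp: fock_dilation.rep_eq norm_mult norm_power power_le_one mult_left_le_one_le)
  then show "norm (fock_dilation z f) \<le> norm f" by (rule power2_le_imp_le) simp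
qed (auto intro!: fock_eqI simp: fock_dilation.rep_eq algebra_simps)

lemma fock_dilation_expvec: "norm z \<le> 1 \<Longrightarrow> fock_dilation z (expvec v) = expvec (z *s v)"
proof (rule fock_eqI)
  fix xs assume z: "norm z \<le> 1"
  have "(\<Prod>i\<leftarrow>xs. z * v $ i) = z ^ length xs * prod_list (map (($) v) xs)"
    by (induction xs) simp_all
  then show "coord (fock_dilation z (expvec v)) xs = coord (expvec (z *s v)) xs"
    using z by (simp add: fock_dilation.rep_eq expvec.rep_eq)
qed

lemma fock_dilation_occ: "norm z \<le> 1 \<Longrightarrow> fock_dilation z (occ M) = z ^ size M *\<^sub>C occ M"
  by (rule fock_eqI) (auto simp: fock_dilation.rep_eq occ.rep_eq)

text \<open>\<open>has_trace\<close> speaks about every orthonormal basis. The freedom in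
  \<open>U\<close> allows summation both over the occupation basis and over its image under a Weyl
  operator.\<close>

lemma orthonormal_occ_has_trace:
  assumes A: "has_trace A t" and U: "unitary_op U"
  shows "((\<lambda>k. \<Sum>M | size M = k. cinner (U (occ M)) (A (U (occ M)))) has_sum t) UNIV"
proof (rule has_sum_group)
  note UB = unitary_image_orthonormal_basis[OF U orthonormal_basis_occ]
  have "((\<lambda>b. cinner b (A b)) has_sum t) (U ` range occ)"
    using A UB(1) unfolding has_trace_def by blast
  then have "((\<lambda>b. cinner (U b) (A (U b))) has_sum t) (range occ)"
    by (simp add: has_sum_reindex[OF UB(2)] o_def)
  then show "((\<lambda>M. cinner (U (occ M)) (A (U (occ M)))) has_sum t) UNIV"
    by (simp add: has_sum_reindex[OF inj_occ] o_def)
qed (rule finite_multisets)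

definition complexify :: "real ^ ('n::finite + 'n) \<Rightarrow> complex ^ 'n" where
  "complexify w = (\<chi> i. Complex (w $ Inl i) (w $ Inr i))"

lemma complexify_sum: "complexify (\<Sum>j\<in>J. y j *\<^sub>R b j) = (\<Sum>j\<in>J. y j *\<^sub>R complexify (b j))"
  by (induction J rule: infinite_finite_induct)
    (auto simp: complexify_def vec_eq_iff complex_eq_iff)

lemma sum_Plus_UNIV: "(\<Sum>k\<in>UNIV. f k) = (\<Sum>i\<in>UNIV. f (Inl i)) + (\<Sum>i\<in>UNIV. f (Inr i))"
  for f :: "'a::finite + 'b::finite \<Rightarrow> 'c::comm_monoid_add"
  unfolding UNIV_sum by (subst sum.union_disjoint) (auto simp: sum.reindex)

lemma norm_complexify: "norm (complexify w) = norm w"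
proof -
  have "(norm (complexify w))\<^sup>2 = (norm w)\<^sup>2"
    by (simp add: norm_vec_def L2_set_def sum_nonneg complexify_def cmod_power2 sum_Plus_UNIV sum.distrib)
  then show ?thesis by simp
qed

lemma cdot_scaleR: "cdot (r *\<^sub>R u) v = complex_of_real r * cdot u v" "cdot u (r *\<^sub>R v) = complex_of_real r * cdot u v"
  by (simp_all add: cdot_def sum_distrib_left scaleR_conv_of_real[of r "_ $ _"] mult_ac)

lemma cdot_sum: "cdot (sum f J) v = (\<Sum>j\<in>J. cdot (f j) v)" "cdot v (sum f J) = (\<Sum>j\<in>J. cdot v (f j))"
proof -
  have "cdot 0 v = 0" "cdot v 0 = 0" by (simp_all add: cdot_def)
  then show "cdot (sum f J) v = (\<Sum>j\<in>J. cdot (f j) v)" "cdot v (sum f J) = (\<Sum>j\<in>J. cdot v (f j))"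
    by (induction J rule: infinite_finite_induct) (simp_all add: cdot_add)
qed

text \<open>Abstracts the eigenbasis of \<open>S\<close>. Integrals run over the coordinates
  \<open>y\<close> with product Lebesgue measure, so Gaussians diagonal in the frame factorise at
  once.\<close>

locale orthonormal_frame =
  fixes J :: "'i set" and b :: "'i \<Rightarrow> real ^ ('n::finite + 'n)"
  assumes finite_J: "finite J" and card_J: "card J = 2 * CARD('n)"
    and orthonormal: "\<And>i j. i \<in> J \<Longrightarrow> j \<in> J \<Longrightarrow> b i \<bullet> b j = (if i = j then 1 else 0)"
begin

abbreviation Leb :: "('i \<Rightarrow> real) measure" where "Leb \<equiv> Pi\<^sub>M J (\<lambda>_. lborel)"

definition frame_vec :: "('i \<Rightarrow> real) \<Rightarrow> real ^ ('n + 'n)" where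
  "frame_vec y = (\<Sum>j\<in>J. y j *\<^sub>R b j)"

text \<open>Up to normalisation, the characteristic function \<open>Tr (z ^ N W(u))\<close> for \<open>z = 1 - s\<close>
  in the coordinates of the frame.\<close>

definition kernel :: "real \<Rightarrow> ('i \<Rightarrow> real) \<Rightarrow> real" where
  "kernel s y = (\<Prod>j\<in>J. 1 / sqrt (pi * s) * exp (- (1 / s - 1 / 2) * (y j)\<^sup>2))"

lemma expand: "x = (\<Sum>j\<in>J. (x \<bullet> b j) *\<^sub>R b j)"
  by (rule orthonormal_family_expand) (auto simp: orthonormal finite_J card_J)

lemma inner_frame_sums: "(\<Sum>j\<in>J. x j *\<^sub>R b j) \<bullet> (\<Sum>j\<in>J. y j *\<^sub>R b j) = (\<Sum>j\<in>J. x j * y j)"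
proof -
  have "(\<Sum>j\<in>J. x j *\<^sub>R b j) \<bullet> (\<Sum>j\<in>J. y j *\<^sub>R b j) = (\<Sum>i\<in>J. \<Sum>j\<in>J. if i = j then x i * y i else 0)"
    unfolding inner_sum_left inner_sum_right by (intro sum.cong refl) (auto simp: orthonormal)
  then show ?thesis by (simp add: finite_J)
qed

lemma norm_vec_sq: "(norm (frame_vec y))\<^sup>2 = (\<Sum>j\<in>J. (y j)\<^sup>2)"
  unfolding power2_norm_eq_inner frame_vec_def inner_frame_sums by (simp add: power2_eq_square)

lemma completeness: "(\<Sum>j\<in>J. b j $ k * b j $ k') = (if k = k' then 1 else 0)"
proof -
  have "axis k (1::real) $ k' = (\<Sum>j\<in>J. (axis k 1 \<bullet> b j) *\<^sub>R b j) $ k'"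
    using expand[of "axis k 1"] by simp
  also have "\<dots> = (\<Sum>j\<in>J. b j $ k * b j $ k')"
    by (simp add: inner_axis')
  finally show ?thesis by (simp add: axis_def eq_commute)
qed

text \<open>Parseval for the frame, extended bilinearly to complex coefficients: squares appear
  instead of squared moduli because they arise from completing complex squares.\<close>

lemma sum_sq_linear_form:
  fixes L :: "'n + 'n \<Rightarrow> complex"
  shows "(\<Sum>j\<in>J. (\<Sum>k\<in>UNIV. L k * complex_of_real (b j $ k))\<^sup>2) = (\<Sum>k\<in>UNIV. (L k)\<^sup>2)"
proof -
  have "(\<Sum>j\<in>J. (\<Sum>k\<in>UNIV. L k * complex_of_real (b j $ k))\<^sup>2)
      = (\<Sum>j\<in>J. \<Sum>k\<in>UNIV. \<Sum>k'\<in>UNIV. L k * L k' * complex_of_real (b j $ k * b j $ k'))"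
    unfolding power2_eq_square sum_product by (simp add: mult_ac)
  also have "\<dots> = (\<Sum>k\<in>UNIV. \<Sum>k'\<in>UNIV. L k * L k' * complex_of_real (\<Sum>j\<in>J. b j $ k * b j $ k'))"
    by (simp add: sum.swap[of _ _ J] sum_distrib_left)
  also have "\<dots> = (\<Sum>k\<in>UNIV. (L k)\<^sup>2)"
    unfolding completeness by (simp add: if_distrib power2_eq_square cong: if_cong)
  finally show ?thesis .
qed

lemma kernel_nonneg: "0 < s \<Longrightarrow> 0 \<le> kernel s y"
  unfolding kernel_def by (intro prod_nonneg) auto

lemma prod_exp: "finite I \<Longrightarrow> (\<Prod>i\<in>I. c * exp (f i)) = c ^ card I * exp (\<Sum>i\<in>I. f i)" for f :: "'i \<Rightarrow> complex"
  by (simp add: prod.distrib exp_sum)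

lemma kernel_complex:
  "complex_of_real (kernel s y) = complex_of_real (1 / sqrt (pi * s)) ^ card J
     * exp (\<Sum>j\<in>J. complex_of_real (- (1 / s - 1 / 2) * (y j)\<^sup>2))"
  unfolding kernel_def of_real_prod of_real_mult exp_of_real[symmetric]
  by (subst prod_exp) (simp_all add: finite_J)

text \<open>Together with the kernel each coordinate has quadratic coefficient
  \<open>1 / s - 1 / 2 + c j\<close>, and \<open>s\<close> times it is
  \<open>1 + s * (c j - 1 / 2)\<close>. The case \<open>c = 0\<close> gives integrability of the
  kernel, \<open>c = 1 / 2\<close> the Weyl matrix elements, \<open>c = lam\<close> the Gaussian
  state.\<close>

lemma gaussian_kernel_integral:
  assumes s: "0 < s" and c: "\<And>j. j \<in> J \<Longrightarrow> 0 < 1 / s - 1 / 2 + c j"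
  shows "has_bochner_integral Leb
    (\<lambda>y. complex_of_real (kernel s y) *
       exp (\<Sum>j\<in>J. complex_of_real (- c j * (y j)\<^sup>2) + \<zeta> j * complex_of_real (y j)))
    (\<Prod>j\<in>J. complex_of_real (1 / sqrt (1 + s * (c j - 1 / 2))) *
       exp (complex_of_real s * (\<zeta> j)\<^sup>2 / (4 * complex_of_real (1 + s * (c j - 1 / 2)))))"
proof -
  let ?a = "\<lambda>j. 1 / s - 1 / 2 + c j"
  have a: "s * ?a j = 1 + s * (c j - 1 / 2)" for j
    using s by (simp add: field_simps)
  have e: "\<zeta> j ^ 2 / (4 * complex_of_real (?a j))
      = complex_of_real s * (\<zeta> j)\<^sup>2 / (4 * complex_of_real (1 + s * (c j - 1 / 2)))" for j
    unfolding a[symmetric] of_real_mult using s by simp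
  have "complex_of_real (kernel s y) *
       exp (\<Sum>j\<in>J. complex_of_real (- c j * (y j)\<^sup>2) + \<zeta> j * complex_of_real (y j))
     = (\<Prod>j\<in>J. complex_of_real (1 / sqrt (pi * s)) *
        exp (complex_of_real (- ?a j * (y j)\<^sup>2) + \<zeta> j * complex_of_real (y j)))" for y
  proof -
    have "(\<Sum>j\<in>J. complex_of_real (- (1 / s - 1 / 2) * (y j)\<^sup>2)) +
          (\<Sum>j\<in>J. complex_of_real (- c j * (y j)\<^sup>2) + \<zeta> j * complex_of_real (y j))
        = (\<Sum>j\<in>J. complex_of_real (- ?a j * (y j)\<^sup>2) + \<zeta> j * complex_of_real (y j))"
      unfolding sum.distrib[symmetric] by (intro sum.cong refl) (simp add: algebra_simps)
    then show ?thesis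
      unfolding kernel_complex by (simp only: prod_exp[OF finite_J] mult.assoc exp_add[symmetric])
  qed
  then show ?thesis
    using gaussian_integral_product[OF finite_J, of ?a s \<zeta>] c s unfolding a e by simp
qed

lemma integrable_kernel:
  assumes "0 < s" "s \<le> 1"
  shows "integrable Leb (kernel s)"
proof -
  have "integrable Leb (\<lambda>y. complex_of_real (kernel s y))"
    using gaussian_kernel_integral[of s "\<lambda>_. 0" "\<lambda>_. 0"] assms
    by (auto simp: has_bochner_integral_iff field_simps)
  then show ?thesis by (simp add: complex_of_real_integrable_eq)
qed

lemma weyl_integral_expvec:
  assumes s: "0 < s" "s \<le> 1"
  shows "has_bochner_integral Leb
    (\<lambda>y. complex_of_real (kernel s y) * cinner (expvec v) (weyl (complexify (frame_vec y)) (expvec w)))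
    (exp ((1 - complex_of_real s) * cdot v w))"
proof -
  \<comment> \<open>For \<open>u = complexify (frame_vec y)\<close> the matrix element is the
    exponential of \<open>cdot v w - (norm u)\<^sup>2 / 2 + cdot v u - cdot u w\<close>;
    \<open>\<zeta> j\<close> is the coefficient of \<open>y j\<close> in the last two terms, and
    \<open>L\<close> is that linear form in real coordinates.\<close>
  define \<zeta> where "\<zeta> j = cdot v (complexify (b j)) - cdot (complexify (b j)) w" for j
  define L where "L = (case_sum (\<lambda>i. cnj (v $ i) - w $ i) (\<lambda>i. \<i> * (cnj (v $ i) + w $ i)))"
  have \<zeta>: "\<zeta> j = (\<Sum>k\<in>UNIV. L k * complex_of_real (b j $ k))" for j
    unfolding \<zeta>_def cdot_def sum_Plus_UNIV sum_subtractf[symmetric] sum.distrib[symmetric]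
    by (intro sum.cong refl) (simp add: L_def complexify_def Complex_eq algebra_simps)
  \<comment> \<open>Each mode adds
    \<open>(cnj v - w)\<^sup>2 - (cnj v + w)\<^sup>2 = - 4 cnj v w\<close>; multiplied by
    \<open>s / 4\<close> this lowers the exponent \<open>cdot v w\<close> by
    \<open>s * cdot v w\<close>.\<close>
  have sq: "(\<Sum>j\<in>J. (\<zeta> j)\<^sup>2) = - 4 * cdot v w"
    unfolding \<zeta> sum_sq_linear_form unfolding sum_Plus_UNIV cdot_def sum_distrib_left sum.distrib[symmetric]
    by (intro sum.cong refl) (simp add: L_def power2_eq_square algebra_simps)
  have "cinner (expvec v) (weyl (complexify (frame_vec y)) (expvec w))
      = exp (cdot v w) * exp (\<Sum>j\<in>J. complex_of_real (- (1 / 2) * (y j)\<^sup>2) + \<zeta> j * complex_of_real (y j))" for y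
  proof -
    have S1: "(\<Sum>j\<in>J. \<zeta> j * complex_of_real (y j)) = cdot v (complexify (frame_vec y)) - cdot (complexify (frame_vec y)) w"
      by (simp add: frame_vec_def complexify_sum cdot_sum cdot_scaleR \<zeta>_def left_diff_distrib right_diff_distrib sum_subtractf mult_ac)
    have S2: "(\<Sum>j\<in>J. complex_of_real (- (1 / 2) * (y j)\<^sup>2)) = - complex_of_real ((norm (complexify (frame_vec y)))\<^sup>2 / 2)"
      unfolding norm_complexify norm_vec_sq by (simp add: sum_negf sum_divide_distrib)
    show ?thesis
      unfolding weyl(2) cinner_scaleC_right cinner_expvec weyl_phase_def mult_exp_exp sum.distrib
      unfolding S1 S2 by (simp add: cdot_add algebra_simps)
  qed
  moreover have "has_bochner_integral Leb
    (\<lambda>y. exp (cdot v w) * (complex_of_real (kernel s y) *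
       exp (\<Sum>j\<in>J. complex_of_real (- (1 / 2) * (y j)\<^sup>2) + \<zeta> j * complex_of_real (y j))))
    (exp (cdot v w) * (\<Prod>j\<in>J. complex_of_real (1 / sqrt (1 + s * (1 / 2 - 1 / 2))) *
       exp (complex_of_real s * (\<zeta> j)\<^sup>2 / (4 * complex_of_real (1 + s * (1 / 2 - 1 / 2))))))"
    using s by (intro has_bochner_integral_mult_right gaussian_kernel_integral) auto
  moreover have "exp (cdot v w) * (\<Prod>j\<in>J. complex_of_real (1 / sqrt (1 + s * (1 / 2 - 1 / 2))) *
       exp (complex_of_real s * (\<zeta> j)\<^sup>2 / (4 * complex_of_real (1 + s * (1 / 2 - 1 / 2)))))
     = exp ((1 - complex_of_real s) * cdot v w)"
  proof -
    have "(\<Sum>j\<in>J. complex_of_real s * (\<zeta> j)\<^sup>2 / 4) = complex_of_real s / 4 * (\<Sum>j\<in>J. (\<zeta> j)\<^sup>2)"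
      by (simp add: sum_distrib_left)
    then show ?thesis unfolding sq
      by (simp add: exp_sum[OF finite_J, symmetric] exp_add[symmetric] algebra_simps)
  qed
  ultimately show ?thesis by (simp add: mult_ac)
qed

text \<open>Weyl operators are isometric and convergent sequences bounded, so a constant multiple of
  the kernel dominates. This supplies the closedness needed for induction over exponential
  vectors.\<close>

lemma weyl_integral_limit:
  assumes s: "0 < s" "s \<le> 1"
    and P: "\<And>n. has_bochner_integral Leb
      (\<lambda>y. complex_of_real (kernel s y) * cinner (F n) (weyl (complexify (frame_vec y)) (G n)))
      (cinner (F n) (fock_dilation z (G n)))"
    and lim: "F \<longlonglongrightarrow> f" "G \<longlonglongrightarrow> g"
  shows "has_bochner_integral Leb
    (\<lambda>y. complex_of_real (kernel s y) * cinner f (weyl (complexify (frame_vec y)) g))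
    (cinner f (fock_dilation z g))"
proof -
  obtain C where C: "norm (F n) \<le> C" for n
    using convergent_imp_bounded[OF lim(1)] by (auto simp: bounded_iff)
  obtain D where D: "norm (G n) \<le> D" for n
    using convergent_imp_bounded[OF lim(2)] by (auto simp: bounded_iff)
  have C0: "0 \<le> C" using C[of 0] norm_ge_zero order_trans by blast
  show ?thesis
  proof (rule has_bochner_integral_dominated_limit[OF P])
    show "(\<lambda>n. cinner (F n) (fock_dilation z (G n))) \<longlonglongrightarrow> cinner f (fock_dilation z g)"
      by (intro tendsto_intros bounded_clinearD(6)[OF bounded_clinear_fock_dilation] lim)
    show "(\<lambda>n. complex_of_real (kernel s y) * cinner (F n) (weyl (complexify (frame_vec y)) (G n)))
        \<longlonglongrightarrow> complex_of_real (kernel s y) * cinner f (weyl (complexify (frame_vec y)) g)" for y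
      by (intro tendsto_intros bounded_clinearD(6)[OF bounded_clinear_weyl] lim)
    show "integrable Leb (\<lambda>y. kernel s y * (C * D))"
      by (intro integrable_mult_left integrable_kernel s)
    show "norm (complex_of_real (kernel s y) * cinner (F n) (weyl (complexify (frame_vec y)) (G n)))
        \<le> kernel s y * (C * D)" for n y
    proof -
      have "norm (cinner (F n) (weyl (complexify (frame_vec y)) (G n))) \<le> norm (F n) * norm (G n)"
        using norm_cinner_le[of "F n" "weyl (complexify (frame_vec y)) (G n)"] by (simp add: norm_weyl)
      also have "\<dots> \<le> C * D" by (intro mult_mono C D C0) simp
      finally show ?thesis
        using kernel_nonneg[OF s(1), of y] by (simp add: norm_mult mult_left_mono)
    qed
  qed
qed

text \<open>The Weyl expansion of \<open>z ^ N\<close>, in the weak sense.\<close>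

lemma weyl_integral:
  assumes s: "0 < s" "s \<le> 1"
  shows "has_bochner_integral Leb
    (\<lambda>y. complex_of_real (kernel s y) * cinner f (weyl (complexify (frame_vec y)) g))
    (cinner f (fock_dilation (complex_of_real (1 - s)) g))"
    (is "?P f g")
proof -
  note W = bounded_clinearD[OF bounded_clinear_weyl]
    and D = bounded_clinearD[OF bounded_clinear_fock_dilation]
  have z: "norm (complex_of_real (1 - s)) \<le> 1" using s by (subst norm_of_real) simp
  have 0: "?P (expvec v) (expvec w)" for v w
  proof -
    have "cinner (expvec v) (fock_dilation (complex_of_real (1 - s)) (expvec w))
        = exp ((1 - complex_of_real s) * cdot v w)"
    proof -
      have "cdot v (c *s w) = c * cdot v w" for c
        by (simp add: cdot_def sum_distrib_left mult_ac)
      then show ?thesis unfolding fock_dilation_expvec[OF z] cinner_expvec by (simp only: of_real_diff of_real_1)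
    qed
    then show ?thesis using weyl_integral_expvec[OF s, of v w] by simp
  qed
  \<comment> \<open>Density is applied to the right argument first, with an exponential vector kept
    on the left.\<close>
  have 1: "?P (expvec v) g" for v g
  proof (rule expvec_induct[of "?P (expvec v)"])
    show "closed {g. ?P (expvec v) g}" unfolding closed_sequential_limits
      by (auto intro: weyl_integral_limit[OF s, where F = "\<lambda>_. expvec v"])
    show "?P (expvec v) (g + h)" if "?P (expvec v) g" "?P (expvec v) h" for g h
      using has_bochner_integral_add[OF that] by (simp add: W(1) D(1) cinner_add_right distrib_left)
    show "?P (expvec v) (c *\<^sub>C expvec w)" for c w
      using has_bochner_integral_mult_right[OF 0[of v w], of c] by (simp add: W(2) D(2) cinner_scaleC_right mult_ac)
  qed
  show ?thesis
  proof (rule expvec_induct[of "\<lambda>f. ?P f g"])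
    show "closed {f. ?P f g}" unfolding closed_sequential_limits
      by (auto intro: weyl_integral_limit[OF s, where G = "\<lambda>_. g"])
    show "?P (f + h) g" if "?P f g" "?P h g" for f h
      using has_bochner_integral_add[OF that] by (simp add: cinner_add_left distrib_left)
    show "?P (c *\<^sub>C expvec v) g" for c v
      using has_bochner_integral_mult_right[OF 1[of v g], of "cnj c"] by (simp add: cinner_scaleC_left mult_ac)
  qed
qed

end

section \<open>The generating function of a Gaussian state\<close>

lemma unitary_id: "unitary_op id"
  by (simp add: unitary_op_def cinner_preserving_imp_bounded_clinear)

text \<open>On a real vector the symplectic term is purely imaginary, so the real part of the form
  is twice that of \<open>S\<close>.\<close>

lemma gaussian_covariance_nonneg:
  fixes S :: "real ^ ('n::finite + 'n) ^ ('n + 'n)"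
  assumes "gaussian_covariance S"
  shows "0 \<le> w \<bullet> (S *v w)"
proof -
  let ?M = "\<chi> i j. 2 * complex_of_real (S $ i $ j) + \<i> * complex_of_real (symplectic_J $ i $ j)"
  let ?z = "\<chi> i. complex_of_real (w $ i)"
  have "0 \<le> Re (cdot ?z (?M *v ?z))"
    using assms by (auto simp: gaussian_covariance_def positive_matrix_def complex_nonneg_Reals_iff)
  also have "Re (cdot ?z (?M *v ?z)) = (\<Sum>i\<in>UNIV. w $ i * (\<Sum>j\<in>UNIV. 2 * S $ i $ j * w $ j))"
    unfolding cdot_def matrix_vector_mult_def by simp
  also have "\<dots> = 2 * (w \<bullet> (S *v w))"
    by (simp add: inner_vec_def matrix_vector_mult_def sum_distrib_left mult_ac)
  finally show ?thesis by simp
qed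

lemma is_gaussian_state_trace:
  assumes "is_gaussian_state l m S \<rho>"
  shows "has_trace (\<rho> \<circ> weyl (complexify w))
    (exp (- \<i> * complex_of_real (sqrt 2 * (stack l (- m) \<bullet> w)) - complex_of_real (w \<bullet> (S *v w))))"
proof -
  define x y where "x = (\<chi> i. w $ Inl i)" and "y = (\<chi> i. w $ Inr i)"
  have "stack x y = w"
    by (auto simp: stack_def vec_eq_iff x_def y_def split: sum.split)
  moreover have "l \<bullet> x - m \<bullet> y = stack l (- m) \<bullet> w"
    by (simp add: inner_vec_def sum_Plus_UNIV stack_def x_def y_def sum_negf)
  moreover have "(\<chi> i. Complex (x $ i) (y $ i)) = complexify w"
    by (simp add: complexify_def x_def y_def)
  ultimately show ?thesis using assms unfolding is_gaussian_state_def by metis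
qed

context orthonormal_frame
begin

lemma eigenvalue_nonneg:
  assumes "gaussian_covariance S" "j \<in> J" "S *v b j = c *\<^sub>R b j"
  shows "0 \<le> c"
  using gaussian_covariance_nonneg[OF assms(1), of "b j"] orthonormal[OF assms(2,2)]
  by (simp add: assms(3))

lemma trace_eq_sum_frame: "trace A = (\<Sum>j\<in>J. b j \<bullet> (A *v b j))"
proof -
  have "(\<Sum>j\<in>J. b j \<bullet> (A *v b j)) = (\<Sum>j\<in>J. \<Sum>k\<in>UNIV. \<Sum>k'\<in>UNIV. A $ k $ k' * (b j $ k * b j $ k'))"
    by (simp add: inner_vec_def matrix_vector_mult_def sum_distrib_left mult_ac)
  also have "\<dots> = (\<Sum>k\<in>UNIV. \<Sum>k'\<in>UNIV. A $ k $ k' * (\<Sum>j\<in>J. b j $ k * b j $ k'))"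
    by (simp add: sum.swap[of _ _ J] sum_distrib_left)
  also have "\<dots> = trace A"
    unfolding completeness trace_def by (simp add: if_distrib cong: if_cong)
  finally show ?thesis ..
qed

text \<open>Both sides evaluate one integral of kernel times characteristic function: splitting the
  trace by particle number gives the series, the closed Gaussian form gives the product.\<close>

lemma gaussian_generating_function:
  assumes \<rho>: "is_gaussian_state l m S \<rho>"
    and eigen: "\<And>j. j \<in> J \<Longrightarrow> S *v b j = lam j *\<^sub>R b j"
    and expansion: "stack l (- m) = (\<Sum>j\<in>J. \<tau> j *\<^sub>R b j)"
    and s: "0 < s" "s \<le> 1"
  shows "(\<lambda>k. number_prob \<rho> k * (1 - s) ^ k) sums
    (\<Prod>j\<in>J. 1 / sqrt (1 + s * (lam j - 1 / 2)) * exp (- (s * (\<tau> j)\<^sup>2 / (2 * (1 + s * (lam j - 1 / 2))))))"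
    (is "_ sums ?G")
proof -
  have pos: "positive_op \<rho>" and tr: "has_trace \<rho> 1"
    using \<rho> by (auto simp: is_gaussian_state_def is_state_def)
  have bc: "bounded_clinear \<rho>" using pos by (simp add: positive_op_def)
  have lam: "0 \<le> lam j" if "j \<in> J" for j
    using eigenvalue_nonneg[OF _ that eigen[OF that]] \<rho> by (simp add: is_gaussian_state_def)
  \<comment> \<open>The characteristic function of the state at \<open>frame_vec y\<close>; in the
    eigenbasis its exponent is a sum over coordinates.\<close>
  define \<phi> where "\<phi> y = exp (\<Sum>j\<in>J. complex_of_real (- lam j * (y j)\<^sup>2)
      + (- \<i> * complex_of_real (sqrt 2 * \<tau> j)) * complex_of_real (y j))" for y
  define W where "W y = weyl (complexify (frame_vec y))" for y
  have tr\<phi>: "has_trace (\<rho> \<circ> W y) (\<phi> y)" for y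
  proof -
    have "stack l (- m) \<bullet> frame_vec y = (\<Sum>j\<in>J. \<tau> j * y j)"
      by (simp add: expansion frame_vec_def inner_frame_sums)
    moreover have "S *v frame_vec y = (\<Sum>j\<in>J. (y j * lam j) *\<^sub>R b j)"
      unfolding frame_vec_def
      by (simp add: linear_sum[OF matrix_vector_mul_linear] matrix_vector_mult_scaleR eigen)
    then have "frame_vec y \<bullet> (S *v frame_vec y) = (\<Sum>j\<in>J. lam j * (y j)\<^sup>2)"
      by (simp add: frame_vec_def inner_frame_sums power2_eq_square mult_ac)
    ultimately have "exp (- \<i> * complex_of_real (sqrt 2 * (stack l (- m) \<bullet> frame_vec y))
        - complex_of_real (frame_vec y \<bullet> (S *v frame_vec y))) = \<phi> y"
      unfolding \<phi>_def by (simp add: sum_distrib_left sum.distrib sum_negf sum_subtractf algebra_simps)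
        (rule arg_cong[where f = exp], rule minus_diff_commute)
    then show ?thesis using is_gaussian_state_trace[OF \<rho>, of "frame_vec y"] by (simp add: W_def)
  qed
  define \<phi>k where "\<phi>k y k = (\<Sum>M | size M = k. cinner (occ M) (\<rho> (W y (occ M))))" for y k
  have \<phi>k: "(\<phi>k y has_sum \<phi> y) UNIV" for y
    using orthonormal_occ_has_trace[OF tr\<phi>[of y] unitary_id] by (simp add: \<phi>k_def[abs_def])
  \<comment> \<open>Averaging the two diagonals of \<rho> gives a bound independent of
    \<open>y\<close>, so that the kernel itself dominates when series and integral are
    exchanged.\<close>
  have partial: "norm (\<Sum>k<n. \<phi>k y k) \<le> 1" for y n
  proof -
    define q where "q U k = (\<Sum>M | size M = k. Re (cinner (U (occ M)) (\<rho> (U (occ M)))))"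
      for U :: "'n fock \<Rightarrow> 'n fock" and k :: nat
    have q: "(\<Sum>k<n. q U k) \<le> 1" if U: "unitary_op U" for U
    proof (rule finite_sum_le_has_sum)
      show "(q U has_sum 1) UNIV"
        using has_sum_Re[OF orthonormal_occ_has_trace[OF tr U]] by (simp add: q_def[abs_def])
      show "0 \<le> q U k" for k
        unfolding q_def using pos by (intro sum_nonneg) (auto simp: positive_op_def complex_nonneg_Reals_iff)
    qed auto
    have "norm (\<phi>k y k) \<le> (q id k + q (W y) k) / 2" for k
    proof -
      have "norm (\<phi>k y k) \<le> (\<Sum>M | size M = k. norm (cinner (occ M) (\<rho> (W y (occ M)))))"
        unfolding \<phi>k_def by (rule norm_sum)
      also have "\<dots> \<le> (\<Sum>M | size M = k. (Re (cinner (occ M) (\<rho> (occ M))) + Re (cinner (W y (occ M)) (\<rho> (W y (occ M))))) / 2)"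
        by (intro sum_mono positive_op_norm_cinner_le pos)
      also have "\<dots> = (q id k + q (W y) k) / 2"
        by (simp add: q_def sum.distrib sum_divide_distrib[symmetric])
      finally show ?thesis .
    qed
    then have "norm (\<Sum>k<n. \<phi>k y k) \<le> (\<Sum>k<n. (q id k + q (W y) k) / 2)"
      by (intro sum_norm_le)
    also have "\<dots> = ((\<Sum>k<n. q id k) + (\<Sum>k<n. q (W y) k)) / 2"
      by (simp add: sum.distrib sum_divide_distrib[symmetric])
    also have "\<dots> \<le> 1" using q[OF unitary_id] q[OF weyl(1)[of "complexify (frame_vec y)"]] by (simp add: W_def)
    finally show ?thesis .
  qed
  have z: "norm (complex_of_real (1 - s)) \<le> 1" using s by (subst norm_of_real) simp
  \<comment> \<open>Selfadjointness moves \<rho> to the left vector, so the weak Weyl expansion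
    applies with \<open>f = \<rho> (occ M)\<close>; on \<open>occ M\<close> the dilation is
    multiplication by \<open>(1 - s) ^ k\<close>.\<close>
  have summand: "has_bochner_integral Leb (\<lambda>y. complex_of_real (kernel s y) * \<phi>k y k)
      (complex_of_real (number_prob \<rho> k * (1 - s) ^ k))" for k
  proof -
    have real: "cinner (occ M) (\<rho> (occ M)) = complex_of_real (Re (cinner (occ M) (\<rho> (occ M))))" for M
      using pos by (auto simp: positive_op_def complex_nonneg_Reals_iff complex_eq_iff)
    have "has_bochner_integral Leb
        (\<lambda>y. \<Sum>M | size M = k. complex_of_real (kernel s y) * cinner (\<rho> (occ M)) (W y (occ M)))
        (\<Sum>M | size M = k. cinner (\<rho> (occ M)) (fock_dilation (complex_of_real (1 - s)) (occ M)))"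
      unfolding W_def by (intro has_bochner_integral_sum weyl_integral s)
    moreover have "(\<Sum>M | size M = k. complex_of_real (kernel s y) * cinner (\<rho> (occ M)) (W y (occ M)))
        = complex_of_real (kernel s y) * \<phi>k y k" for y
      by (simp add: \<phi>k_def sum_distrib_left positive_op_selfadjoint[OF pos])
    moreover have "(\<Sum>M | size M = k. cinner (\<rho> (occ M)) (fock_dilation (complex_of_real (1 - s)) (occ M)))
        = complex_of_real (number_prob \<rho> k * (1 - s) ^ k)"
      unfolding number_prob_eq[OF bc] of_real_mult of_real_sum sum_distrib_right
      by (intro sum.cong refl)
        (simp only: fock_dilation_occ[OF z] cinner_scaleC_right positive_op_selfadjoint[OF pos, symmetric]
          real[symmetric] of_real_power mult.commute mem_Collect_eq)
    ultimately show ?thesis by simp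
  qed
  have G: "has_bochner_integral Leb (\<lambda>y. complex_of_real (kernel s y) * \<phi> y) (complex_of_real ?G)"
  proof -
    have *: "0 < 1 / s - 1 / 2 + lam j" if "j \<in> J" for j
    proof -
      have "1 \<le> 1 / s" using s by simp
      then show ?thesis using lam[OF that] by linarith
    qed
    have "complex_of_real s * (- \<i> * complex_of_real (sqrt 2 * \<tau> j))\<^sup>2 / (4 * complex_of_real (1 + s * (lam j - 1 / 2)))
        = complex_of_real (- (s * (\<tau> j)\<^sup>2 / (2 * (1 + s * (lam j - 1 / 2)))))" for j
    proof -
      have "(- \<i> * complex_of_real (sqrt 2 * \<tau> j))\<^sup>2 = complex_of_real (- 2 * (\<tau> j)\<^sup>2)"
        by (simp add: power_mult_distrib flip: of_real_power)
      moreover have "complex_of_real s * complex_of_real (- 2 * t) / (4 * complex_of_real d)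
          = complex_of_real (- (s * t / (2 * d)))" for t d
        by simp
      ultimately show ?thesis by (simp only:)
    qed
    then show ?thesis
      using gaussian_kernel_integral[where c = lam and \<zeta> = "\<lambda>j. - \<i> * complex_of_real (sqrt 2 * \<tau> j)", OF s(1) *]
      unfolding \<phi>_def by (simp only: exp_of_real of_real_prod of_real_mult)
  qed
  have "(\<lambda>n. LINT y|Leb. (\<Sum>k<n. complex_of_real (kernel s y) * \<phi>k y k))
      \<longlonglongrightarrow> (LINT y|Leb. complex_of_real (kernel s y) * \<phi> y)"
  proof (rule integral_dominated_convergence[where w = "kernel s"])
    show "(\<lambda>y. complex_of_real (kernel s y) * \<phi> y) \<in> borel_measurable Leb"
      using G by (intro borel_measurable_integrable integrable.intros)
    show "(\<lambda>y. \<Sum>k<n. complex_of_real (kernel s y) * \<phi>k y k) \<in> borel_measurable Leb" for n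
      by (intro borel_measurable_sum borel_measurable_integrable integrable.intros[OF summand])
    show "integrable Leb (kernel s)" by (rule integrable_kernel[OF s])
    show "AE y in Leb. (\<lambda>n. \<Sum>k<n. complex_of_real (kernel s y) * \<phi>k y k) \<longlonglongrightarrow> complex_of_real (kernel s y) * \<phi> y"
      using has_sum_imp_sums[OF \<phi>k] by (intro AE_I2) (auto simp: sums_def[symmetric] intro: sums_mult)
    show "AE y in Leb. norm (\<Sum>k<n. complex_of_real (kernel s y) * \<phi>k y k) \<le> kernel s y" for n
    proof (intro AE_I2)
      fix y
      have "norm (\<Sum>k<n. complex_of_real (kernel s y) * \<phi>k y k) = kernel s y * norm (\<Sum>k<n. \<phi>k y k)"
        using kernel_nonneg[OF s(1), of y] by (simp add: sum_distrib_left[symmetric] norm_mult)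
      also have "\<dots> \<le> kernel s y"
        using kernel_nonneg[OF s(1), of y] partial[of y n] by (simp add: mult_left_le)
      finally show "norm (\<Sum>k<n. complex_of_real (kernel s y) * \<phi>k y k) \<le> kernel s y" .
    qed
  qed
  moreover have "(LINT y|Leb. (\<Sum>k<n. complex_of_real (kernel s y) * \<phi>k y k))
      = (\<Sum>k<n. complex_of_real (number_prob \<rho> k * (1 - s) ^ k))" for n
    by (rule has_bochner_integral_integral_eq) (intro has_bochner_integral_sum summand)
  ultimately have "(\<lambda>k. complex_of_real (number_prob \<rho> k * (1 - s) ^ k)) sums complex_of_real ?G"
    unfolding sums_def has_bochner_integral_integral_eq[OF G] by simp
  then show ?thesis by (simp only: sums_of_real_iff)
qed

end

lemma number_prob_nonneg:
  assumes "positive_op \<rho>"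
  shows "0 \<le> number_prob \<rho> k"
  using assms by (subst number_prob_eq)
    (auto simp: positive_op_def complex_nonneg_Reals_iff intro!: sum_nonneg)

lemma number_prob_has_sum:
  assumes "is_state \<rho>"
  shows "(number_prob \<rho> has_sum 1) UNIV"
proof -
  have tr: "has_trace \<rho> 1" and bc: "bounded_clinear \<rho>"
    using assms by (auto simp: is_state_def positive_op_def)
  have "((\<lambda>k. Re (\<Sum>M | size M = k. cinner (occ M) (\<rho> (occ M)))) has_sum Re 1) UNIV"
    using has_sum_Re[OF orthonormal_occ_has_trace[OF tr unitary_id]] by simp
  then show ?thesis by (simp add: number_prob_eq[OF bc, abs_def])
qed

section \<open>Moments from the generating function\<close>

text \<open>Finite sums stay below \<open>L\<close> in the limit, as in Fatou's lemma; domination of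
  \<open>t s k\<close> by its own limit gives the reverse inequality. Summability of
  \<open>p k * T k\<close> is a result here, not an assumption.\<close>

lemma has_sum_of_limit_of_lower_bounds:
  fixes p T :: "nat \<Rightarrow> real" and t :: "real \<Rightarrow> nat \<Rightarrow> real"
  assumes p: "\<And>k. 0 \<le> p k" and T0: "\<And>k. 0 \<le> T k"
    and tT: "\<And>s k. 0 < s \<Longrightarrow> s \<le> 1 \<Longrightarrow> t s k \<le> T k"
    and t0: "\<And>s k. 0 < s \<Longrightarrow> s \<le> 1 \<Longrightarrow> 0 \<le> t s k"
    and lim: "\<And>k. ((\<lambda>s. t s k) \<longlongrightarrow> T k) (at_right 0)"
    and H: "\<And>s. 0 < s \<Longrightarrow> s \<le> 1 \<Longrightarrow> ((\<lambda>k. p k * t s k) has_sum H s) UNIV"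
    and L: "(H \<longlongrightarrow> L) (at_right 0)"
  shows "((\<lambda>k. p k * T k) has_sum L) UNIV"
proof -
  have ev: "\<forall>\<^sub>F s in at_right (0::real). 0 < s \<and> s \<le> 1"
    by (rule eventually_at_rightI[of 0 1]) auto
  have fin: "(\<Sum>k\<in>F. p k * T k) \<le> L" if F: "finite F" for F
  proof (rule tendsto_le[OF trivial_limit_at_right_real L])
    show "((\<lambda>s. \<Sum>k\<in>F. p k * t s k) \<longlongrightarrow> (\<Sum>k\<in>F. p k * T k)) (at_right 0)"
      by (intro tendsto_intros lim)
    show "\<forall>\<^sub>F s in at_right 0. (\<Sum>k\<in>F. p k * t s k) \<le> H s"
      using ev by eventually_elim (rule finite_sum_le_has_sum[OF H]; use F p t0 in auto)
  qed
  have "(\<lambda>k. p k * T k) summable_on UNIV"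
    by (rule nonneg_bdd_above_summable_on) (use p T0 fin in \<open>auto intro!: bdd_aboveI[of _ L]\<close>)
  then obtain Z where Z: "((\<lambda>k. p k * T k) has_sum Z) UNIV"
    using summable_on_def by blast
  have "Z \<le> L" by (rule has_sum_le_finite_sums[OF Z]) (rule fin)
  moreover have "L \<le> Z"
  proof (rule tendsto_upperbound[OF L])
    show "\<forall>\<^sub>F s in at_right 0. H s \<le> Z"
      using ev by eventually_elim (rule has_sum_mono[OF H Z]; use p tT in \<open>auto intro: mult_left_mono\<close>)
  qed simp
  ultimately show ?thesis using Z by simp
qed

text \<open>Taylor bounds at \<open>s = 0\<close>. The first two keep the difference quotients
  between 0 and their limits; the third identifies the second-order limit, and its constant
  \<open>real k ^ 3\<close> is crude but survives the induction.\<close>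

lemma one_minus_power_bounds:
  fixes s :: real
  assumes s: "0 \<le> s" "s \<le> 1"
  shows "1 - real k * s \<le> (1 - s) ^ k"
    and "(1 - s) ^ k \<le> 1 - real k * s + real k * (real k - 1) / 2 * s\<^sup>2"
    and "1 - real k * s + real k * (real k - 1) / 2 * s\<^sup>2 - real k ^ 3 * s ^ 3 \<le> (1 - s) ^ k"
proof -
  show "1 - real k * s \<le> (1 - s) ^ k"
    using Bernoulli_inequality[of "- s" k] s by simp
  show "(1 - s) ^ k \<le> 1 - real k * s + real k * (real k - 1) / 2 * s\<^sup>2"
  proof (induction k)
    case (Suc k)
    have "(1 - s) ^ Suc k \<le> (1 - s) * (1 - real k * s + real k * (real k - 1) / 2 * s\<^sup>2)"
      using Suc s by (simp add: mult_left_mono)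
    also have "\<dots> = 1 - real (Suc k) * s + real (Suc k) * (real (Suc k) - 1) / 2 * s\<^sup>2
        - real k * (real k - 1) / 2 * s ^ 3"
      by (simp add: power2_eq_square power3_eq_cube field_simps)
    also have "\<dots> \<le> 1 - real (Suc k) * s + real (Suc k) * (real (Suc k) - 1) / 2 * s\<^sup>2"
      \<comment> \<open>\<open>real k * (real k - 1)\<close> is nonnegative also at
        \<open>k = 0\<close>, where the first factor vanishes.\<close>
      using s by (cases k) auto
    finally show ?case .
  qed simp
  show "1 - real k * s + real k * (real k - 1) / 2 * s\<^sup>2 - real k ^ 3 * s ^ 3 \<le> (1 - s) ^ k"
  proof (induction k)
    case (Suc k)
    have "real k ^ 3 * s ^ 3 + real k * (real k - 1) / 2 * s ^ 3 - real k ^ 3 * s ^ 4 \<le> real (Suc k) ^ 3 * s ^ 3"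
    proof -
      have "real k ^ 3 + real k * (real k - 1) / 2 \<le> real (Suc k) ^ 3"
        by (simp add: power2_eq_square power3_eq_cube field_simps)
      then have "(real k ^ 3 + real k * (real k - 1) / 2) * s ^ 3 \<le> real (Suc k) ^ 3 * s ^ 3"
        using s by (intro mult_right_mono) auto
      moreover have "0 \<le> real k ^ 3 * s ^ 4" using s by simp
      ultimately show ?thesis unfolding distrib_right by linarith
    qed
    then have "1 - real (Suc k) * s + real (Suc k) * (real (Suc k) - 1) / 2 * s\<^sup>2 - real (Suc k) ^ 3 * s ^ 3
        \<le> 1 - real (Suc k) * s + real (Suc k) * (real (Suc k) - 1) / 2 * s\<^sup>2
          - (real k ^ 3 * s ^ 3 + real k * (real k - 1) / 2 * s ^ 3 - real k ^ 3 * s ^ 4)"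
      by linarith
    also have "\<dots> = (1 - s) * (1 - real k * s + real k * (real k - 1) / 2 * s\<^sup>2 - real k ^ 3 * s ^ 3)"
      by (simp add: power2_eq_square power3_eq_cube power4_eq_xxxx field_simps)
    also have "\<dots> \<le> (1 - s) ^ Suc k" using Suc s by (simp add: mult_left_mono)
    finally show ?case .
  qed simp
qed

text \<open>Here \<open>G s\<close> is \<open>1 + A * s + B * s\<^sup>2\<close> up to
  \<open>o(s\<^sup>2)\<close>, to be compared with \<open>1 - k s + k (k - 1) / 2 s\<^sup>2\<close>
  in each term; hence the sign of \<open>A\<close>. The mean comes first because the second-order
  quotient contains \<open>real k * s\<close>, whose sum must already be known.\<close>

lemma moments_of_generating_function:
  fixes p :: "nat \<Rightarrow> real"
  assumes p: "\<And>k. 0 \<le> p k" and one: "(p has_sum 1) UNIV"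
    and G: "\<And>s. 0 < s \<Longrightarrow> s \<le> 1 \<Longrightarrow> (\<lambda>k. p k * (1 - s) ^ k) sums G s"
    and lim: "((\<lambda>s. (G s - 1 - A * s) / s\<^sup>2) \<longlongrightarrow> B) (at_right 0)"
  shows "((\<lambda>k. p k * real k) has_sum - A) UNIV"
    and "((\<lambda>k. p k * (real k * (real k - 1) / 2)) has_sum B) UNIV"
proof -
  define t2 where "t2 s k = ((1 - s) ^ k - 1 + real k * s) / s\<^sup>2" for s k
  have ev: "\<forall>\<^sub>F s in at_right (0::real). 0 < s \<and> s \<le> 1"
    by (rule eventually_at_rightI[of 0 1]) auto
  have Gh: "((\<lambda>k. p k * (1 - s) ^ k) has_sum G s) UNIV" if "0 < s" "s \<le> 1" for s
    by (rule sums_nonneg_imp_has_sum[OF G[OF that]]) (use p that in auto)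
  have t2_0: "0 \<le> t2 s k" and t2_T: "t2 s k \<le> real k * (real k - 1) / 2"
    and t2_l: "real k * (real k - 1) / 2 - real k ^ 3 * s \<le> t2 s k" if s: "0 < s" "s \<le> 1" for s k
  proof -
    note b = one_minus_power_bounds[of s k, OF less_imp_le[OF s(1)] s(2)]
    show "0 \<le> t2 s k" using b(1) by (simp add: t2_def)
    show "t2 s k \<le> real k * (real k - 1) / 2"
      using b(2) s by (simp add: t2_def pos_divide_le_eq)
    have "(real k * (real k - 1) / 2 - real k ^ 3 * s) * s\<^sup>2 = real k * (real k - 1) / 2 * s\<^sup>2 - real k ^ 3 * s ^ 3"
      by (simp add: left_diff_distrib power2_eq_square power3_eq_cube)
    then show "real k * (real k - 1) / 2 - real k ^ 3 * s \<le> t2 s k"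
      using b(3) s by (simp add: t2_def pos_le_divide_eq)
  qed
  have t2_lim: "((\<lambda>s. t2 s k) \<longlongrightarrow> real k * (real k - 1) / 2) (at_right 0)" for k
  proof (rule tendsto_sandwich)
    show "\<forall>\<^sub>F s in at_right 0. real k * (real k - 1) / 2 - real k ^ 3 * s \<le> t2 s k"
      using ev by eventually_elim (rule t2_l; simp)
    show "\<forall>\<^sub>F s in at_right 0. t2 s k \<le> real k * (real k - 1) / 2"
      using ev by eventually_elim (rule t2_T; simp)
    show "((\<lambda>s. real k * (real k - 1) / 2 - real k ^ 3 * s) \<longlongrightarrow> real k * (real k - 1) / 2) (at_right 0)"
      by (rule tendsto_eq_intros refl | simp)+
  qed simp
  show 1: "((\<lambda>k. p k * real k) has_sum - A) UNIV"
  proof (rule has_sum_of_limit_of_lower_bounds[where t = "\<lambda>s k. (1 - (1 - s) ^ k) / s" and H = "\<lambda>s. (1 - G s) / s"])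
    fix s :: real and k assume s: "0 < s" "s \<le> 1"
    show "(1 - (1 - s) ^ k) / s \<le> real k"
      using one_minus_power_bounds(1)[of s k] s by (simp add: pos_divide_le_eq)
    show "0 \<le> (1 - (1 - s) ^ k) / s" using s by (simp add: power_le_one)
  next
    fix k
    have "((\<lambda>s. real k - s * t2 s k) \<longlongrightarrow> real k - 0 * (real k * (real k - 1) / 2)) (at_right 0)"
      by (intro tendsto_intros t2_lim)
    moreover have "\<forall>\<^sub>F s in at_right 0. real k - s * t2 s k = (1 - (1 - s) ^ k) / s"
      using ev by eventually_elim (auto simp: t2_def power2_eq_square field_simps)
    ultimately show "((\<lambda>s. (1 - (1 - s) ^ k) / s) \<longlongrightarrow> real k) (at_right 0)"
      by (simp add: tendsto_cong)
  next
    fix s :: real assume s: "0 < s" "s \<le> 1"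
    have "((\<lambda>k. (p k + (- 1) * (p k * (1 - s) ^ k)) * (1 / s)) has_sum ((1 + (- 1) * G s) * (1 / s))) UNIV"
      by (intro has_sum_cmult_left has_sum_add one has_sum_cmult_right Gh s)
    then show "((\<lambda>k. p k * ((1 - (1 - s) ^ k) / s)) has_sum (1 - G s) / s) UNIV"
      by (simp add: algebra_simps diff_divide_distrib)
  next
    have "((\<lambda>s. - A - s * ((G s - 1 - A * s) / s\<^sup>2)) \<longlongrightarrow> - A - 0 * B) (at_right 0)"
      by (intro tendsto_intros lim)
    moreover have "\<forall>\<^sub>F s in at_right 0. - A - s * ((G s - 1 - A * s) / s\<^sup>2) = (1 - G s) / s"
      using ev by eventually_elim (auto simp: power2_eq_square field_simps)
    ultimately show "((\<lambda>s. (1 - G s) / s) \<longlongrightarrow> - A) (at_right 0)"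
      by (simp add: tendsto_cong)
  qed (use p in auto)
  show "((\<lambda>k. p k * (real k * (real k - 1) / 2)) has_sum B) UNIV"
  proof (rule has_sum_of_limit_of_lower_bounds[where t = t2 and H = "\<lambda>s. (G s - 1 - A * s) / s\<^sup>2"])
    fix s :: real assume s: "0 < s" "s \<le> 1"
    have "((\<lambda>k. (p k * (1 - s) ^ k + (- 1) * p k + s * (p k * real k)) * (1 / s\<^sup>2))
        has_sum ((G s + (- 1) * 1 + s * (- A)) * (1 / s\<^sup>2))) UNIV"
      by (intro has_sum_cmult_left has_sum_add one has_sum_cmult_right Gh s 1)
    then show "((\<lambda>k. p k * t2 s k) has_sum (G s - 1 - A * s) / s\<^sup>2) UNIV"
      by (simp add: t2_def algebra_simps diff_divide_distrib add_divide_distrib)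
  next
    show "0 \<le> real k * (real k - 1) / 2" for k by (cases k) auto
  qed (use p t2_0 t2_T t2_lim lim in auto)
qed

text \<open>The logarithm of the generating function is a sum over eigenvectors, so the expansion is
  done there and carried over by the exponential, which contributes
  \<open>A\<^sup>2 / 2\<close>.\<close>

lemma second_order_expansion_exp:
  fixes g :: "real \<Rightarrow> real"
  assumes g: "((\<lambda>s. (g s - A * s) / s\<^sup>2) \<longlongrightarrow> C) (at_right 0)"
  shows "((\<lambda>s. (exp (g s) - 1 - A * s) / s\<^sup>2) \<longlongrightarrow> A\<^sup>2 / 2 + C) (at_right 0)"
proof -
  \<comment> \<open>The continuous extension of the exponential remainder, so that points with
    \<open>g s = 0\<close> cause no division by zero; it splits \<open>exp x - 1\<close> into
    \<open>x + h x * x\<^sup>2\<close>.\<close>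
  define h where "h x = (if x = 0 then 1 / 2 else (exp x - 1 - x) / x\<^sup>2)" for x :: real
  have "((\<lambda>x. (exp x - 1 - x) / x\<^sup>2) \<longlongrightarrow> (1 / 2 :: real)) (at 0)" by real_asymp
  moreover have "\<forall>\<^sub>F x in at (0::real). (exp x - 1 - x) / x\<^sup>2 = h x"
    by (auto simp: eventually_at_filter h_def)
  ultimately have "h \<midarrow>0\<rightarrow> 1 / 2" by (rule Lim_transform_eventually)
  then have h: "h \<midarrow>0\<rightarrow> h 0" by (simp add: h_def)
  have ev: "\<forall>\<^sub>F s in at_right (0::real). 0 < s" by (rule eventually_at_right_less)
  have "((\<lambda>s. A + s * ((g s - A * s) / s\<^sup>2)) \<longlongrightarrow> A + 0 * C) (at_right 0)"
    by (intro tendsto_intros g)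
  moreover have "\<forall>\<^sub>F s in at_right 0. A + s * ((g s - A * s) / s\<^sup>2) = g s / s"
    using ev by eventually_elim (auto simp: power2_eq_square field_simps)
  ultimately have gs: "((\<lambda>s. g s / s) \<longlongrightarrow> A) (at_right 0)" by (simp add: tendsto_cong)
  have "((\<lambda>s. s * (g s / s)) \<longlongrightarrow> 0 * A) (at_right 0)" by (intro tendsto_intros gs)
  moreover have "\<forall>\<^sub>F s in at_right 0. s * (g s / s) = g s" using ev by eventually_elim auto
  ultimately have g0: "(g \<longlongrightarrow> 0) (at_right 0)" by (simp add: tendsto_cong)
  have "((\<lambda>s. h (g s)) \<longlongrightarrow> h 0) (at_right 0)"
    using h g0 by (intro isCont_tendsto_compose[of 0 h]) (auto simp: isCont_def)
  then have "((\<lambda>s. h (g s) * (g s / s)\<^sup>2 + (g s - A * s) / s\<^sup>2) \<longlongrightarrow> h 0 * A\<^sup>2 + C) (at_right 0)"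
    by (intro tendsto_intros gs g)
  moreover have "\<forall>\<^sub>F s in at_right 0. h (g s) * (g s / s)\<^sup>2 + (g s - A * s) / s\<^sup>2 = (exp (g s) - 1 - A * s) / s\<^sup>2"
    using ev by eventually_elim (auto simp: h_def power_divide field_simps)
  ultimately show ?thesis by (simp add: tendsto_cong h_def)
qed

text \<open>The contribution of one eigenvector. Only the logarithm needs an asymptotic expansion;
  the displacement term obeys the exact identity \<open>s \<tau>\<^sup>2 - s \<tau>\<^sup>2 / d =
  s\<^sup>2 \<tau>\<^sup>2 \<mu> / d\<close> with \<open>d = 1 + s \<mu>\<close>.\<close>

lemma second_order_expansion_log_factor:
  fixes \<mu> \<tau> :: real
  shows "((\<lambda>s. (- ln (1 + s * \<mu>) / 2 - s * \<tau>\<^sup>2 / (2 * (1 + s * \<mu>)) - (- (\<mu> + \<tau>\<^sup>2) / 2) * s) / s\<^sup>2)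
    \<longlongrightarrow> \<mu>\<^sup>2 / 4 + \<tau>\<^sup>2 * \<mu> / 2) (at_right 0)"
proof -
  have L: "((\<lambda>s. (s * \<mu> - ln (1 + s * \<mu>)) / s\<^sup>2) \<longlongrightarrow> \<mu>\<^sup>2 / 2) (at_right 0)"
  \<comment> \<open>At \<open>\<mu> = 0\<close> the quotient is identically zero.\<close>
  proof (cases "\<mu> = 0")
    case False
    then have "((\<lambda>s. (s * \<mu> - ln (1 + s * \<mu>)) / s\<^sup>2) \<longlongrightarrow> \<mu> * \<mu> / 2) (at_right 0)" by real_asymp
    then show ?thesis by (simp add: power2_eq_square)
  qed simp
  have "((\<lambda>s. (s * \<mu> - ln (1 + s * \<mu>)) / s\<^sup>2 / 2 + \<tau>\<^sup>2 * \<mu> / (2 * (1 + s * \<mu>)))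
      \<longlongrightarrow> \<mu>\<^sup>2 / 2 / 2 + \<tau>\<^sup>2 * \<mu> / (2 * (1 + 0 * \<mu>))) (at_right 0)"
    by (intro L tendsto_intros) auto
  moreover have "\<forall>\<^sub>F s in at_right 0. 0 < s \<and> 1 + s * \<mu> \<noteq> 0"
  proof (intro eventually_conj eventually_at_right_less)
    have "((\<lambda>s. 1 + s * \<mu>) \<longlongrightarrow> 1 + 0 * \<mu>) (at_right 0)" by (intro tendsto_intros)
    then show "\<forall>\<^sub>F s in at_right 0. 1 + s * \<mu> \<noteq> 0" by (rule tendsto_imp_eventually_ne) simp
  qed
  then have "\<forall>\<^sub>F s in at_right 0. (s * \<mu> - ln (1 + s * \<mu>)) / s\<^sup>2 / 2 + \<tau>\<^sup>2 * \<mu> / (2 * (1 + s * \<mu>))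
      = (- ln (1 + s * \<mu>) / 2 - s * \<tau>\<^sup>2 / (2 * (1 + s * \<mu>)) - (- (\<mu> + \<tau>\<^sup>2) / 2) * s) / s\<^sup>2"
  proof eventually_elim
    fix s assume s: "0 < s \<and> 1 + s * \<mu> \<noteq> 0"
    define d where "d = 1 + s * \<mu>"
    have "s * \<tau>\<^sup>2 - s * \<tau>\<^sup>2 / d = s\<^sup>2 * (\<tau>\<^sup>2 * \<mu> / d)"
      using s by (simp add: d_def field_simps power2_eq_square)
    then have "\<tau>\<^sup>2 * \<mu> / d = (s * \<tau>\<^sup>2 - s * \<tau>\<^sup>2 / d) / s\<^sup>2" using s by simp
    then have 1: "\<tau>\<^sup>2 * \<mu> / (2 * d) = (s * \<tau>\<^sup>2 - s * \<tau>\<^sup>2 / d) / s\<^sup>2 / 2"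
      by (metis divide_divide_eq_left mult.commute)
    have 2: "- ln d / 2 - s * \<tau>\<^sup>2 / (2 * d) - (- (\<mu> + \<tau>\<^sup>2) / 2) * s
        = ((s * \<mu> - ln d) + (s * \<tau>\<^sup>2 - s * \<tau>\<^sup>2 / d)) / 2"
      by (simp add: add_divide_distrib diff_divide_distrib algebra_simps)
    then show "(s * \<mu> - ln (1 + s * \<mu>)) / s\<^sup>2 / 2 + \<tau>\<^sup>2 * \<mu> / (2 * (1 + s * \<mu>))
      = (- ln (1 + s * \<mu>) / 2 - s * \<tau>\<^sup>2 / (2 * (1 + s * \<mu>)) - (- (\<mu> + \<tau>\<^sup>2) / 2) * s) / s\<^sup>2"
      unfolding d_def[symmetric] 1 2 by (simp add: add_divide_distrib mult.commute)
  qed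
  ultimately show ?thesis by (simp add: tendsto_cong)
qed


theorem corollary3p1:
  fixes \<rho> :: "'n::finite fock \<Rightarrow> 'n fock"
    and l m :: "real ^ 'n"
    and S :: "real ^ ('n + 'n) ^ ('n + 'n)"
    and lam \<tau> \<alpha> :: "nat \<Rightarrow> real"
    and b :: "nat \<Rightarrow> real ^ ('n + 'n)"
  assumes gaussian: "is_gaussian_state l m S \<rho>"
    and eigen: "\<forall>j\<in>{1..2 * CARD('n)}. S *v b j = lam j *\<^sub>R b j"
    and orthonormal: "\<forall>i\<in>{1..2 * CARD('n)}. \<forall>j\<in>{1..2 * CARD('n)}.
                        b i \<bullet> b j = (if i = j then 1 else 0)"
    and decreasing: "\<forall>i\<in>{1..2 * CARD('n)}. \<forall>j\<in>{1..2 * CARD('n)}. i \<le> j \<longrightarrow> lam j \<le> lam i"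
    and expansion: "stack l (- m) = (\<Sum>j=1..2 * CARD('n). \<tau> j *\<^sub>R b j)"
    and alpha: "\<forall>j\<in>{1..2 * CARD('n)}. \<alpha> j = (lam j - 1 / 2) / (lam j + 1 / 2)"
  shows
    "number_prob \<rho> 0 =
       (\<Prod>j=1..2 * CARD('n). sqrt (1 - \<alpha> j) * exp (- (1 / 2) * (\<tau> j)\<^sup>2 * (1 - \<alpha> j)))
     \<and> ((\<lambda>k. real k * number_prob \<rho> k) summable_on UNIV \<and>
        number_mean \<rho> = 1 / 2 * (trace (S - (1 / 2) *\<^sub>R mat 1) + (norm (stack l (- m)))\<^sup>2))
     \<and> ((\<lambda>k. (real k - number_mean \<rho>)\<^sup>2 * number_prob \<rho> k) summable_on UNIV \<and>
        number_variance \<rho> =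
          1 / 2 * trace ((S - (1 / 2) *\<^sub>R mat 1) ** (S + (1 / 2) *\<^sub>R mat 1))
          + stack l (- m) \<bullet> (S *v stack l (- m)))"
proof -
  define J where "J = {1..2 * CARD('n)}"
  interpret orthonormal_frame J b
  proof unfold_locales
    show "finite J" "card J = 2 * CARD('n)" by (simp_all add: J_def)
    show "b i \<bullet> b j = (if i = j then 1 else 0)" if "i \<in> J" "j \<in> J" for i j
      using orthonormal that unfolding J_def by blast
  qed
  have eig: "S *v b j = lam j *\<^sub>R b j" if "j \<in> J" for j using eigen that by (simp add: J_def)
  have ex: "stack l (- m) = (\<Sum>j\<in>J. \<tau> j *\<^sub>R b j)" using expansion by (simp add: J_def)
  have st: "is_state \<rho>" and cov: "gaussian_covariance S"
    using gaussian by (auto simp: is_gaussian_state_def)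
  have lam: "0 \<le> lam j" if "j \<in> J" for j using eigenvalue_nonneg[OF cov that eig[OF that]] .
  define \<mu> where "\<mu> j = lam j - 1 / 2" for j
  \<comment> \<open>\<open>1 + s * \<mu> j = (1 - s / 2) + s * lam j\<close>, and
    \<open>s \<le> 1\<close> keeps the first summand at least 1/2.\<close>
  have pos: "0 < 1 + s * \<mu> j" if "0 < s" "s \<le> 1" "j \<in> J" for s j
  proof -
    have "s * (1 / 2) \<le> 1 / 2" "0 \<le> s * lam j" using lam[OF that(3)] that by auto
    then show ?thesis by (simp add: \<mu>_def right_diff_distrib)
  qed
  have exp_ln_half: "exp (- ln x / 2) = 1 / sqrt x" if "0 < x" for x :: real
  proof -
    have "exp (- ln x / 2) = exp (- ln (sqrt x))" using that by (simp add: ln_sqrt)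
    also have "\<dots> = 1 / sqrt x" using that by (simp only: exp_minus inverse_eq_divide) simp
    finally show ?thesis .
  qed
  have exp_diff_eq: "exp (x - y) = exp x * exp (- y)" for x y :: real
    by (simp only: exp_diff exp_minus divide_inverse)
  define p where "p = number_prob \<rho>"
  \<comment> \<open>The logarithm of the generating function, turning the product over eigenvectors
    into a sum.\<close>
  define g where "g s = (\<Sum>j\<in>J. - ln (1 + s * \<mu> j) / 2 - s * (\<tau> j)\<^sup>2 / (2 * (1 + s * \<mu> j)))" for s
  have gen: "(\<lambda>k. p k * (1 - s) ^ k) sums exp (g s)" if s: "0 < s" "s \<le> 1" for s
  proof -
    have "exp (g s) = (\<Prod>j\<in>J. 1 / sqrt (1 + s * \<mu> j) * exp (- (s * (\<tau> j)\<^sup>2 / (2 * (1 + s * \<mu> j)))))"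
      unfolding g_def exp_sum[OF finite_J]
    proof (rule prod.cong[OF refl])
      fix j assume "j \<in> J"
      then have "exp (- ln (1 + s * \<mu> j) / 2) = 1 / sqrt (1 + s * \<mu> j)"
        using pos[OF s] by (intro exp_ln_half)
      then show "exp (- ln (1 + s * \<mu> j) / 2 - s * (\<tau> j)\<^sup>2 / (2 * (1 + s * \<mu> j)))
          = 1 / sqrt (1 + s * \<mu> j) * exp (- (s * (\<tau> j)\<^sup>2 / (2 * (1 + s * \<mu> j))))"
        by (simp only: exp_diff_eq)
    qed
    then show ?thesis
      using gaussian_generating_function[OF gaussian eig ex s] by (simp only: \<mu>_def p_def)
  qed
  have p0: "0 \<le> p k" for k
    using st by (auto simp: p_def is_state_def intro: number_prob_nonneg)
  have p1: "(p has_sum 1) UNIV" unfolding p_def by (rule number_prob_has_sum[OF st])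

  \<comment> \<open>With \<open>0 ^ 0 = 1\<close> only the term \<open>k = 0\<close> survives at
    \<open>s = 1\<close>.\<close>
  have "(\<lambda>k. p k * (1 - 1) ^ k) sums p 0" by simp
  then have "p 0 = exp (g 1)" using gen[OF zero_less_one order_refl] by (rule sums_unique2)
  also have "\<dots> = (\<Prod>j\<in>J. sqrt (1 - \<alpha> j) * exp (- (1 / 2) * (\<tau> j)\<^sup>2 * (1 - \<alpha> j)))"
    unfolding g_def exp_sum[OF finite_J]
  proof (rule prod.cong[OF refl])
    fix j assume j: "j \<in> J"
    \<comment> \<open>Both sides equal \<open>1 / (lam j + 1 / 2)\<close>.\<close>
    have a: "1 - \<alpha> j = 1 / (1 + 1 * \<mu> j)"
      using alpha lam[OF j] j by (simp add: J_def \<mu>_def field_simps)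
    have "exp (- ln (1 + 1 * \<mu> j) / 2) = sqrt (1 - \<alpha> j)"
      unfolding a real_sqrt_divide real_sqrt_one using pos[of 1 j] j by (intro exp_ln_half) simp
    then show "exp (- ln (1 + 1 * \<mu> j) / 2 - 1 * (\<tau> j)\<^sup>2 / (2 * (1 + 1 * \<mu> j)))
        = sqrt (1 - \<alpha> j) * exp (- (1 / 2) * (\<tau> j)\<^sup>2 * (1 - \<alpha> j))"
      by (simp only: exp_diff_eq) (simp add: a)
  qed
  finally have i: "p 0 = (\<Prod>j\<in>J. sqrt (1 - \<alpha> j) * exp (- (1 / 2) * (\<tau> j)\<^sup>2 * (1 - \<alpha> j)))" .

  \<comment> \<open>\<open>A\<close> and \<open>C\<close> are the coefficients of \<open>s\<close>
    and \<open>s\<^sup>2\<close> in the logarithm of the generating function: \<open>- A\<close> is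
    the mean and \<open>2 * C\<close> the second factorial cumulant.\<close>
  define A where "A = (\<Sum>j\<in>J. - (\<mu> j + (\<tau> j)\<^sup>2) / 2)"
  have A: "(\<Sum>j\<in>J. - (\<mu> j + (\<tau> j)\<^sup>2) / 2 * s) = A * s" for s
    by (simp only: A_def sum_distrib_right)
  define C where "C = (\<Sum>j\<in>J. (\<mu> j)\<^sup>2 / 4 + (\<tau> j)\<^sup>2 * \<mu> j / 2)"
  have "((\<lambda>s. \<Sum>j\<in>J. (- ln (1 + s * \<mu> j) / 2 - s * (\<tau> j)\<^sup>2 / (2 * (1 + s * \<mu> j)) - (- (\<mu> j + (\<tau> j)\<^sup>2) / 2) * s) / s\<^sup>2)
      \<longlongrightarrow> C) (at_right 0)"
    unfolding C_def by (intro tendsto_sum second_order_expansion_log_factor)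
  then have "((\<lambda>s. (g s - A * s) / s\<^sup>2) \<longlongrightarrow> C) (at_right 0)"
    by (simp only: sum_divide_distrib[where A = J and r = "_\<^sup>2", symmetric] sum_subtractf[of _ "\<lambda>j. - (\<mu> j + (\<tau> j)\<^sup>2) / 2 * _"] A g_def)
  then have lim: "((\<lambda>s. (exp (g s) - 1 - A * s) / s\<^sup>2) \<longlongrightarrow> A\<^sup>2 / 2 + C) (at_right 0)"
    by (rule second_order_expansion_exp)
  note M = moments_of_generating_function[OF p0 p1 gen lim]

  have mean_sum: "((\<lambda>k. real k * p k) has_sum - A) UNIV" using M(1) by (simp add: mult.commute)
  have mean: "number_mean \<rho> = - A"
    unfolding number_mean_def using infsumI[OF mean_sum] by (simp add: p_def)
  \<comment> \<open>Centring at the mean \<open>- A\<close>: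
    \<open>(k + A)\<^sup>2 = k (k - 1) + (1 + 2 A) k + A\<^sup>2\<close>, a combination of the two
    factorial moments and the total mass. The term \<open>A\<^sup>2 / 2\<close> from exponentiation
    cancels, leaving \<open>2 * C - A\<close>.\<close>
  have "((\<lambda>k. 2 * (p k * (real k * (real k - 1) / 2)) + (1 + 2 * A) * (p k * real k) + A\<^sup>2 * p k)
      has_sum 2 * (A\<^sup>2 / 2 + C) + (1 + 2 * A) * (- A) + A\<^sup>2 * 1) UNIV"
    by (intro has_sum_add has_sum_cmult_right M p1)
  moreover have "2 * (p k * (real k * (real k - 1) / 2)) + (1 + 2 * A) * (p k * real k) + A\<^sup>2 * p k
      = (real k - number_mean \<rho>)\<^sup>2 * p k" for k
    unfolding mean by (simp add: power2_eq_square field_simps)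
  moreover have "2 * (A\<^sup>2 / 2 + C) + (1 + 2 * A) * (- A) + A\<^sup>2 * 1 = 2 * C - A"
    by (simp add: power2_eq_square algebra_simps)
  ultimately have var_sum: "((\<lambda>k. (real k - number_mean \<rho>)\<^sup>2 * p k) has_sum 2 * C - A) UNIV"
    by (simp only:)
  have var: "number_variance \<rho> = 2 * C - A"
    unfolding number_variance_def using infsumI[OF var_sum] by (simp add: p_def)

  \<comment> \<open>Traces and quadratic forms are evaluated in the eigenbasis, where both shifted
    matrices are diagonal.\<close>
  have minus: "(S - (1 / 2) *\<^sub>R mat 1) *v b j = \<mu> j *\<^sub>R b j" if "j \<in> J" for j
    by (simp add: matrix_vector_mult_diff_rdistrib scaleR_matrix_vector_assoc[symmetric] eig[OF that] \<mu>_def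
        scaleR_left_diff_distrib)
  have plus: "(S + (1 / 2) *\<^sub>R mat 1) *v b j = (lam j + 1 / 2) *\<^sub>R b j" if "j \<in> J" for j
    by (simp add: matrix_vector_mult_add_rdistrib scaleR_matrix_vector_assoc[symmetric] eig[OF that]
        scaleR_left_distrib)
  have tr1: "trace (S - (1 / 2) *\<^sub>R mat 1) = (\<Sum>j\<in>J. \<mu> j)"
    unfolding trace_eq_sum_frame by (intro sum.cong refl) (simp add: minus orthonormal)
  have tr2: "trace ((S - (1 / 2) *\<^sub>R mat 1) ** (S + (1 / 2) *\<^sub>R mat 1)) = (\<Sum>j\<in>J. \<mu> j * (lam j + 1 / 2))"
    unfolding trace_eq_sum_frame
    by (intro sum.cong refl)
      (simp add: matrix_vector_mul_assoc[symmetric] plus matrix_vector_mult_scaleR minus orthonormal)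
  have nrm: "(norm (stack l (- m)))\<^sup>2 = (\<Sum>j\<in>J. (\<tau> j)\<^sup>2)"
    unfolding power2_norm_eq_inner ex inner_frame_sums by (simp add: power2_eq_square)
  have "S *v stack l (- m) = (\<Sum>j\<in>J. (\<tau> j * lam j) *\<^sub>R b j)"
    unfolding ex by (simp add: linear_sum[OF matrix_vector_mul_linear] matrix_vector_mult_scaleR eig)
  then have quad: "stack l (- m) \<bullet> (S *v stack l (- m)) = (\<Sum>j\<in>J. (\<tau> j)\<^sup>2 * lam j)"
    by (simp add: ex inner_frame_sums power2_eq_square mult_ac)
  have ii: "- A = 1 / 2 * ((\<Sum>j\<in>J. \<mu> j) + (\<Sum>j\<in>J. (\<tau> j)\<^sup>2))"
    unfolding A_def sum.distrib[symmetric] sum_distrib_left sum_negf[symmetric]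
    by (intro sum.cong refl) (simp add: field_simps)
  \<comment> \<open>Termwise this is
    \<open>\<mu> (\<mu> + 1) / 2 + \<tau>\<^sup>2 (\<mu> + 1 / 2)\<close>, with
    \<open>\<mu> + 1 = lam + 1 / 2\<close> and \<open>\<mu> + 1 / 2 = lam\<close>.\<close>
  have iii: "2 * C - A = 1 / 2 * (\<Sum>j\<in>J. \<mu> j * (lam j + 1 / 2)) + (\<Sum>j\<in>J. (\<tau> j)\<^sup>2 * lam j)"
    unfolding A_def C_def sum_distrib_left sum_subtractf[symmetric] sum.distrib[symmetric]
    by (intro sum.cong refl) (simp add: \<mu>_def power2_eq_square field_simps)
  show ?thesis
    unfolding tr1 tr2 nrm quad ii[symmetric] iii[symmetric]
    using i mean var has_sum_imp_summable[OF mean_sum] has_sum_imp_summable[OF var_sum]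
    by (simp add: p_def J_def)
qed

end
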